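(* Let $\mu$ be a Borel measure on $M_2(\mathbb{R})$ and $s>0$ a real number such that $\int\varphi^s(A)\,d\mu(A)<\infty$. Then \[\int\varphi^s(A)\,d\mu_2(A)\leq\tilde K_s\,e^{\mathbf{P}(\mu,s)}\int\varphi^s(A)\,d\mu(A)\] where $\tilde K_s:=2^{3+2s}$ if $0<s\leq1$, $\tilde K_s:=2^{7-2s}$ if $1\leq s<2$, and $\tilde K_s:=1$ if $s\geq2$.
   Context: $M_2(\mathbb{R})$ is the space of real $2\times2$ matrices; $\sigma_1(A)\geq\sigma_2(A)$ are the singular values of $A$. For $s>0$: $\varphi^s(A):=\sigma_1(A)^s$ if $0<s\leq1$; $\varphi^s(A):=\sigma_1(A)\sigma_2(A)^{s-1}$ if $1\leq s\leq2$ (with $0^0:=1$); $\varphi^s(A):=|\det A|^{s/2}$ if $s\geq2$. For a Borel measure $\mu$ on $M_2(\mathbb{R})$ and $n\geq1$, $\mu_n$ is given by $\mu_n(X):=(\mu\times\cdots\times\mu)(\{(A_1,\ldots,A_n)\in M_2(\mathbb{R})^n: A_1\cdots A_n\in X\})$ ($n$ copies of $\mu$), so that $\int f\,d\mu_n=\int f(A_1\cdots A_n)\,d\mu(A_1)\cdots d\mu(A_n)$. If $\int\varphi^s\,d\mu<\infty$, the singular value pressure is $\mathbf{P}(\mu,s):=\lim_{n\to\infty}\frac1n\log\left(\int\varphi^s(A)\,d\mu_n(A)\right)\in[-\infty,+\infty)$ (the limit exists by subadditivity). Conventions: $\log0:=-\infty$, $e^{-\infty}:=0$. *)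

theory Defs
  imports "HOL-Analysis.Analysis"
begin

type_synonym mat2 = "real ^ 2 ^ 2"

definition gram_eigenvalues :: "mat2 \<Rightarrow> real set" where
  "gram_eigenvalues A = {l. \<exists>v. v \<noteq> 0 \<and> (transpose A ** A) *v v = l *\<^sub>R v}"

(* A 2x2 symmetric matrix has one or two distinct eigenvalues, so the largest and the smallest
   element of the set below list them with multiplicity; the singular values are their roots. *)

definition sigma1 :: "mat2 \<Rightarrow> real" where
  "sigma1 A = sqrt (Max (gram_eigenvalues A))"

definition sigma2 :: "mat2 \<Rightarrow> real" where
  "sigma2 A = sqrt (Min (gram_eigenvalues A))"

(* For 1 <= s <= 2 the factor sigma2 A powr (s - 1) is to be read with 0^0 = 1, whereas
   Isabelle has 0 powr 0 = 0. The only exponent affected is s = 1, where under that convention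
   the value is sigma1 A; it is supplied by the first branch. *)

definition phi :: "real \<Rightarrow> mat2 \<Rightarrow> real" where
  "phi s A =
     (if s \<le> 1 then sigma1 A powr s
      else if s \<le> 2 then sigma1 A * sigma2 A powr (s - 1)
      else \<bar>det A\<bar> powr (s / 2))"

(* The product A 1 ** ... ** A n. The type class operation on real ^ 2 ^ 2 written with a
   single star is the componentwise product, so prod_list cannot be used. *)

definition mat_product :: "nat \<Rightarrow> (nat \<Rightarrow> mat2) \<Rightarrow> mat2" where
  "mat_product n A = foldr (**) (map A [1..<Suc n]) (mat 1)"

(* The image under matrix multiplication of the product of n copies of mu. The measure mu need
   not be sigma-finite: PiM is then some measure giving every measurable box the product of
   the measures of its sides. *)

definition mu_pow :: "mat2 measure \<Rightarrow> nat \<Rightarrow> mat2 measure" where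
  "mu_pow \<mu> n = distr (PiM {1..n} (\<lambda>_. \<mu>)) borel (mat_product n)"

definition log_ext :: "ennreal \<Rightarrow> ereal" where
  "log_ext x = (if x = 0 then -\<infinity> else if x = \<infinity> then \<infinity> else ereal (ln (enn2real x)))"

definition exp_ext :: "ereal \<Rightarrow> ennreal" where
  "exp_ext x =
     (if x = -\<infinity> then 0 else if x = \<infinity> then \<infinity> else ennreal (exp (real_of_ereal x)))"

(* The term for n = 0 is irrelevant to the limit. *)

definition pressure :: "mat2 measure \<Rightarrow> real \<Rightarrow> ereal" where
  "pressure \<mu> s =
     lim (\<lambda>n. ereal (1 / real n) * log_ext (\<integral>\<^sup>+A. ennreal (phi s A) \<partial>mu_pow \<mu> n))"

definition K_tilde :: "real \<Rightarrow> real" where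
  "K_tilde s =
     (if s \<le> 1 then 2 powr (3 + 2 * s)
      else if s < 2 then 2 powr (7 - 2 * s)
      else 1)"

end

theory Submission
  imports Defs
begin
text \<open>
  For $s<2$ one can write $\varphi^s(A)=W(A)\,\sigma_1(A)^t$ with a multiplicative weight $W\ge0$ and an
  exponent $t\in(0,1]$: take $W=1$, $t=s$ for $s\le1$, and $W=|\det|^{s-1}$, $t=2-s$ for $1<s<2$. For
  $s\ge2$ the function $\varphi^s$ is itself multiplicative. In all cases it is submultiplicative, so the
  numbers $I_n=\int\varphi^s\,d\mu_n$ satisfy $I_{m+n}\le I_mI_n$, and by Fekete's lemma the pressure is the
  infimum of $\frac1n\log I_n$. It therefore suffices to show $I_2\le\tilde K_s\,y\,I_1$ whenever
  $I_m\le y^m$ for some $m\ge1$, and to let $y$ decrease to $e^{\mathbf P}$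
  (\<open>le_exp_ext_lim_growth_rate\<close>). For $s\ge2$ this is clear, since $I_m=I_1^m$.

  For $s<2$ and such $m$, $y$ consider $f(v)=\sum_{k<m}y^{-k}\int W(X)|Xv|^t\,d\mu_k(X)$. It is homogeneous of
  degree $t$, subadditive, at least $|v|^t$, and a shift of the summation index gives
  $\int W(A)f(Av)\,d\mu(A)\le y\,f(v)$ (\<open>adapted_norm_contraction\<close>). Let $e$ be a unit vector at which $f$ is
  minimal on the unit circle up to a factor $2$, and let $e'$ be orthogonal to it. In this basis
  the contraction property controls the averages of the first column and of the lower right entry
  of $A$. The upper right entry is not controlled, but in a product $XA$ it is always multiplied
  by the first column of $X$. So every term of $XA$ has one factor whose average is bounded by a
  multiple of $y$, while the other factor is bounded by the norm. This gives
  $I_2\le 7\,y\,I_1$ (\<open>nn_integral_wnorm_mu_pow_2_le\<close>), and $7\le2^3\le\tilde K_s$.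

  The measure $\mu$ may fail to be \<open>\<sigma>\<close>-finite on the set where $\varphi^s$ vanishes. A product
  $A_1\cdots A_n$ with a factor in this set does not contribute to $I_n$, so $\mu$ may be restricted to the
  complement, where it is \<open>\<sigma>\<close>-finite because $\varphi^s$ is integrable
  (\<open>nn_integral_mu_pow_nonvanishing_part\<close>). Comparing the product measures before and after the
  restriction requires the volume of boxes under a product of arbitrary measures
  (\<open>emeasure_PiM_box\<close>).
\<close>

(* The index sets {1..n} would otherwise be rewritten to {Suc 0..n}. *)
declare One_nat_def [simp del]

section \<open>Singular values of two by two matrices\<close>

definition frob_sq :: "mat2 \<Rightarrow> real" where
  "frob_sq A = (A$1$1)\<^sup>2 + (A$1$2)\<^sup>2 + (A$2$1)\<^sup>2 + (A$2$2)\<^sup>2"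

definition disc :: "mat2 \<Rightarrow> real" where
  "disc A = (frob_sq A)\<^sup>2 - 4 * (det A)\<^sup>2"

lemmas mat2_simps = vec_eq_iff forall_2 sum_2 matrix_matrix_mult_def matrix_vector_mult_def transpose_def det_2

text \<open>
  The sum of squares is the discriminant of the Gram matrix in the form $(p-r)^2+4q^2$,
  which shows that both eigenvalues are real.
\<close>
lemma disc_eq:
  "disc A = ((A$1$1)\<^sup>2 + (A$2$1)\<^sup>2 - (A$1$2)\<^sup>2 - (A$2$2)\<^sup>2)\<^sup>2 + 4 * (A$1$1 * A$1$2 + A$2$1 * A$2$2)\<^sup>2"
  unfolding disc_def frob_sq_def det_2 by algebra

lemma disc_nonneg: "0 \<le> disc A"
  unfolding disc_eq by simp

lemma singular_2x2_system:
  fixes a b c d :: real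
  shows "(\<exists>x y. (x \<noteq> 0 \<or> y \<noteq> 0) \<and> a * x + b * y = 0 \<and> c * x + d * y = 0) \<longleftrightarrow> a * d - b * c = 0"
proof
  assume "\<exists>x y. (x \<noteq> 0 \<or> y \<noteq> 0) \<and> a * x + b * y = 0 \<and> c * x + d * y = 0"
  then obtain x y where *: "x \<noteq> 0 \<or> y \<noteq> 0" "a * x + b * y = 0" "c * x + d * y = 0" by auto
  have "(a * d - b * c) * x = 0" "(a * d - b * c) * y = 0"
    using *(2,3) by algebra+
  with *(1) show "a * d - b * c = 0" by auto
next
  assume *: "a * d - b * c = 0"
  show "\<exists>x y. (x \<noteq> 0 \<or> y \<noteq> 0) \<and> a * x + b * y = 0 \<and> c * x + d * y = 0"
  proof (cases "a = 0 \<and> b = 0")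
    case True
    show ?thesis
    proof (cases "c = 0 \<and> d = 0")
      case True
      with \<open>a = 0 \<and> b = 0\<close> show ?thesis by (intro exI[of _ 1]) auto
    next
      case False
      with True show ?thesis by (intro exI[of _ d] exI[of _ "-c"]) auto
    qed
  next
    case False
    with * show ?thesis by (intro exI[of _ b] exI[of _ "-a"]) (auto simp: algebra_simps)
  qed
qed

lemma exists_vector_2: "(\<exists>v::real^2. P (v$1) (v$2)) \<longleftrightarrow> (\<exists>x y. P x y)"
proof
  assume "\<exists>x y. P x y"
  then obtain x y where "P x y" by blast
  then show "\<exists>v::real^2. P (v$1) (v$2)"
    by (intro exI[of _ "vector [x, y]"]) simp
qed blast

text \<open>
  The quadratic is the characteristic polynomial of the Gram matrix: the trace of
  $A^{\mathsf T}A$ is the sum of the squared entries, and its determinant is $(\det A)^2$.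
\<close>
lemma gram_eigenvalues_iff:
  "l \<in> gram_eigenvalues A \<longleftrightarrow> l\<^sup>2 - frob_sq A * l + (det A)\<^sup>2 = 0"
proof -
  have "l \<in> gram_eigenvalues A \<longleftrightarrow> (\<exists>v::real^2. (v$1 \<noteq> 0 \<or> v$2 \<noteq> 0) \<and>
      ((A$1$1)\<^sup>2 + (A$2$1)\<^sup>2 - l) * v$1 + (A$1$1 * A$1$2 + A$2$1 * A$2$2) * v$2 = 0 \<and>
      (A$1$1 * A$1$2 + A$2$1 * A$2$2) * v$1 + ((A$1$2)\<^sup>2 + (A$2$2)\<^sup>2 - l) * v$2 = 0)"
    unfolding gram_eigenvalues_def by (auto simp: mat2_simps algebra_simps power2_eq_square)
  also have "\<dots> \<longleftrightarrow> (\<exists>x y. (x \<noteq> 0 \<or> y \<noteq> 0) \<and>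
      ((A$1$1)\<^sup>2 + (A$2$1)\<^sup>2 - l) * x + (A$1$1 * A$1$2 + A$2$1 * A$2$2) * y = 0 \<and>
      (A$1$1 * A$1$2 + A$2$1 * A$2$2) * x + ((A$1$2)\<^sup>2 + (A$2$2)\<^sup>2 - l) * y = 0)"
    by (rule exists_vector_2[where P = "\<lambda>x y. (x \<noteq> 0 \<or> y \<noteq> 0) \<and>
      ((A$1$1)\<^sup>2 + (A$2$1)\<^sup>2 - l) * x + (A$1$1 * A$1$2 + A$2$1 * A$2$2) * y = 0 \<and>
      (A$1$1 * A$1$2 + A$2$1 * A$2$2) * x + ((A$1$2)\<^sup>2 + (A$2$2)\<^sup>2 - l) * y = 0"])
  also have "\<dots> \<longleftrightarrow> l\<^sup>2 - frob_sq A * l + (det A)\<^sup>2 = 0"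
    unfolding singular_2x2_system frob_sq_def det_2 by (simp add: algebra_simps power2_eq_square)
  finally show ?thesis .
qed

lemma gram_eigenvalues_eq:
  "gram_eigenvalues A = {(frob_sq A - sqrt (disc A)) / 2, (frob_sq A + sqrt (disc A)) / 2}"
proof -
  have "l\<^sup>2 - frob_sq A * l + (det A)\<^sup>2 = 0 \<longleftrightarrow>
      (l - (frob_sq A - sqrt (disc A)) / 2) * (l - (frob_sq A + sqrt (disc A)) / 2) = 0" for l
  proof -
    have "(l - (frob_sq A - sqrt (disc A)) / 2) * (l - (frob_sq A + sqrt (disc A)) / 2)
        = l\<^sup>2 - frob_sq A * l + ((frob_sq A)\<^sup>2 - (sqrt (disc A))\<^sup>2) / 4"
      by (simp add: field_simps power2_eq_square)
    also have "\<dots> = l\<^sup>2 - frob_sq A * l + (det A)\<^sup>2"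
      using disc_nonneg[of A] by (simp add: disc_def)
    finally show ?thesis by simp
  qed
  then show ?thesis
    unfolding set_eq_iff gram_eigenvalues_iff by simp
qed

lemma sigma1_formula: "sigma1 A = sqrt ((frob_sq A + sqrt (disc A)) / 2)"
  unfolding sigma1_def gram_eigenvalues_eq by (simp add: disc_nonneg)

lemma sigma2_formula: "sigma2 A = sqrt ((frob_sq A - sqrt (disc A)) / 2)"
  unfolding sigma2_def gram_eigenvalues_eq by (simp add: disc_nonneg)

lemma frob_sq_nonneg: "0 \<le> frob_sq A" by (simp add: frob_sq_def)

lemma sqrt_disc_le_frob_sq: "sqrt (disc A) \<le> frob_sq A"
  using frob_sq_nonneg[of A] by (intro real_le_lsqrt) (auto simp: disc_def)

lemma sigma1_nonneg: "0 \<le> sigma1 A"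
  by (simp add: sigma1_formula disc_nonneg frob_sq_nonneg)

lemma sigma2_nonneg: "0 \<le> sigma2 A"
  by (simp add: sigma2_formula sqrt_disc_le_frob_sq)

lemma sigma1_mult_sigma2: "sigma1 A * sigma2 A = \<bar>det A\<bar>"
proof -
  have "sigma1 A * sigma2 A = sqrt (((frob_sq A)\<^sup>2 - (sqrt (disc A))\<^sup>2) / 4)"
    unfolding sigma1_formula sigma2_formula real_sqrt_mult[symmetric]
    by (simp add: field_simps power2_eq_square)
  also have "\<dots> = sqrt ((det A)\<^sup>2)"
    using disc_nonneg[of A] by (simp add: disc_def)
  finally show ?thesis by simp
qed

lemma sigma1_square_eigenvalue:
  "frob_sq A + sqrt (disc A) = 2 * (sigma1 A)\<^sup>2" "(sigma1 A)\<^sup>2 \<in> gram_eigenvalues A"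
proof -
  have "0 \<le> (frob_sq A + sqrt (disc A)) / 2"
    using disc_nonneg[of A] frob_sq_nonneg[of A] by simp
  then have "(sigma1 A)\<^sup>2 = (frob_sq A + sqrt (disc A)) / 2"
    unfolding sigma1_formula by (rule real_sqrt_pow2)
  then show "frob_sq A + sqrt (disc A) = 2 * (sigma1 A)\<^sup>2" "(sigma1 A)\<^sup>2 \<in> gram_eigenvalues A"
    unfolding gram_eigenvalues_eq by simp_all
qed

text \<open>
  The matrix $\sigma_1(A)^2 I - A^{\mathsf T}A$ has determinant $0$, since $\sigma_1(A)^2$ is an
  eigenvalue, and nonnegative diagonal entries, since it is the larger one. A symmetric
  $2\times2$ matrix of this kind is positive semidefinite.
\<close>
lemma norm_mult_square_le: "(norm (A *v v))\<^sup>2 \<le> (sigma1 A)\<^sup>2 * (norm v)\<^sup>2"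
proof -
  define L p q r where "L = (sigma1 A)\<^sup>2" and "p = (A$1$1)\<^sup>2 + (A$2$1)\<^sup>2"
    and "q = A$1$1 * A$1$2 + A$2$1 * A$2$2" and "r = (A$1$2)\<^sup>2 + (A$2$2)\<^sup>2"
  have "L\<^sup>2 - frob_sq A * L + (det A)\<^sup>2 = 0"
    using sigma1_square_eigenvalue(2) by (simp add: gram_eigenvalues_iff L_def)
  then have eq: "(L - p) * (L - r) = q\<^sup>2"
    unfolding frob_sq_def det_2 p_def q_def r_def by algebra
  have "\<bar>p - r\<bar> \<le> sqrt (disc A)"
    unfolding disc_eq p_def r_def by (intro real_le_rsqrt) (simp add: algebra_simps)
  moreover have "p + r + sqrt (disc A) = 2 * L"
    using sigma1_square_eigenvalue(1)[of A] by (simp add: frob_sq_def L_def p_def r_def)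
  ultimately have nonneg: "0 \<le> L - p" "0 \<le> L - r"
    by linarith+
  have "0 \<le> (L - p) * (v$1)\<^sup>2 - 2 * q * (v$1 * v$2) + (L - r) * (v$2)\<^sup>2"
  proof (cases "L - p = 0")
    case True
    with eq have "q = 0" by simp
    with nonneg True show ?thesis by simp
  next
    case False
    have "(L - p) * ((L - p) * (v$1)\<^sup>2 - 2 * q * (v$1 * v$2) + (L - r) * (v$2)\<^sup>2)
        = ((L - p) * v$1 - q * v$2)\<^sup>2"
      using eq by algebra
    then have "0 \<le> (L - p) * ((L - p) * (v$1)\<^sup>2 - 2 * q * (v$1 * v$2) + (L - r) * (v$2)\<^sup>2)"
      by (simp only: zero_le_power2)
    with False nonneg(1) show ?thesis
      by (simp add: zero_le_mult_iff)
  qed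
  moreover have "(norm (A *v v))\<^sup>2 = p * (v$1)\<^sup>2 + 2 * q * (v$1 * v$2) + r * (v$2)\<^sup>2"
    unfolding power2_norm_eq_inner inner_vec_def p_def q_def r_def
    by (simp add: mat2_simps algebra_simps power2_eq_square)
  moreover have "(norm v)\<^sup>2 = (v$1)\<^sup>2 + (v$2)\<^sup>2"
    unfolding power2_norm_eq_inner inner_vec_def by (simp add: sum_2 power2_eq_square)
  ultimately show ?thesis
    unfolding L_def by (simp add: algebra_simps)
qed

lemma norm_matrix_vector_le_sigma1: "norm (A *v v) \<le> sigma1 A * norm v"
proof (rule power2_le_imp_le)
  show "(norm (A *v v))\<^sup>2 \<le> (sigma1 A * norm v)\<^sup>2"
    using norm_mult_square_le[of A v] by (simp only: power_mult_distrib)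
  show "0 \<le> sigma1 A * norm v"
    using sigma1_nonneg[of A] by simp
qed

lemma sigma1_attained: "\<exists>v. v \<noteq> 0 \<and> norm (A *v v) = sigma1 A * norm v"
proof -
  obtain v where v: "v \<noteq> 0" "(transpose A ** A) *v v = (sigma1 A)\<^sup>2 *\<^sub>R v"
    using sigma1_square_eigenvalue(2)[of A] by (auto simp: gram_eigenvalues_def)
  have "(norm (A *v v))\<^sup>2 = inner v ((transpose A ** A) *v v)"
    unfolding power2_norm_eq_inner
    by (metis dot_lmul_matrix inner_commute matrix_vector_mul_assoc transpose_matrix_vector)
  then have "(norm (A *v v))\<^sup>2 = (sigma1 A * norm v)\<^sup>2"
    unfolding v(2) by (simp add: power2_norm_eq_inner power_mult_distrib)
  then have "norm (A *v v) = sigma1 A * norm v"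
    using sigma1_nonneg[of A] by (simp add: power2_eq_iff_nonneg)
  with v(1) show ?thesis by blast
qed

text \<open>
  With \<open>norm_matrix_vector_le_sigma1\<close> this identifies \<^term>\<open>sigma1 A\<close> as the operator norm.
\<close>
lemma sigma1_le:
  assumes "\<And>v. norm (A *v v) \<le> c * norm v"
  shows "sigma1 A \<le> c"
proof -
  obtain v where "v \<noteq> 0" "norm (A *v v) = sigma1 A * norm v"
    using sigma1_attained by blast
  with assms[of v] show ?thesis by simp
qed

lemma sigma1_mult_le: "sigma1 (A ** B) \<le> sigma1 A * sigma1 B"
proof (rule sigma1_le)
  fix v
  have "norm ((A ** B) *v v) \<le> sigma1 A * norm (B *v v)"
    by (metis matrix_vector_mul_assoc norm_matrix_vector_le_sigma1)
  also have "\<dots> \<le> sigma1 A * (sigma1 B * norm v)"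
    by (intro mult_left_mono norm_matrix_vector_le_sigma1 sigma1_nonneg)
  finally show "norm ((A ** B) *v v) \<le> sigma1 A * sigma1 B * norm v"
    by (simp add: mult.assoc)
qed

lemma borel_measurable_mat2_nth [measurable]: "(\<lambda>A::mat2. A $ i $ j) \<in> borel_measurable borel"
  by (rule borel_measurable_continuous_onI, rule continuous_on_component,
      rule continuous_on_component, rule continuous_on_id)

lemma borel_measurable_det [measurable]: "(\<lambda>A::mat2. det A) \<in> borel_measurable borel"
  unfolding det_2 by measurable

lemma borel_measurable_sigma1 [measurable]: "sigma1 \<in> borel_measurable borel"
proof -
  have "(\<lambda>A. sqrt ((frob_sq A + sqrt (disc A)) / 2)) \<in> borel_measurable borel"
    unfolding disc_def frob_sq_def by measurable
  then show ?thesis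
    by (simp flip: sigma1_formula)
qed

lemma phi_eq_le_1: "s \<le> 1 \<Longrightarrow> phi s A = sigma1 A powr s"
  by (simp add: phi_def)

text \<open>
  Since $\sigma_1\sigma_2=|\det|$, all the dependence on $\sigma_2$ can be moved into a power of the
  determinant, which is multiplicative; what remains is a power of the norm with exponent
  $2-s$ between $0$ and $1$, just as in the range $s\le1$.
\<close>
lemma phi_eq_between:
  assumes "1 < s" "s < 2"
  shows "phi s A = \<bar>det A\<bar> powr (s - 1) * sigma1 A powr (2 - s)"
proof (cases "sigma1 A = 0")
  case False
  then have "sigma1 A * sigma2 A powr (s - 1)
      = (sigma1 A powr (s - 1) * sigma1 A powr (2 - s)) * sigma2 A powr (s - 1)"
    using sigma1_nonneg[of A] by (simp flip: powr_add)
  also have "\<dots> = (sigma1 A * sigma2 A) powr (s - 1) * sigma1 A powr (2 - s)"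
    using sigma1_nonneg[of A] sigma2_nonneg[of A] by (simp add: powr_mult)
  finally show ?thesis using assms by (simp add: phi_def sigma1_mult_sigma2)
next
  case True
  with assms show ?thesis by (simp add: phi_def)
qed

text \<open>
  The point $s=2$ fits in because $\sigma_1\sigma_2=|\det|$. So the function is exactly multiplicative
  for all $s\ge2$.
\<close>
lemma phi_eq_ge_2:
  assumes "2 \<le> s"
  shows "phi s A = \<bar>det A\<bar> powr (s / 2)"
proof (cases "s = 2")
  case True
  then show ?thesis
    by (simp add: phi_def sigma2_nonneg sigma1_mult_sigma2)
next
  case False
  with assms show ?thesis by (simp add: phi_def)
qed

lemma borel_measurable_phi [measurable]: "phi s \<in> borel_measurable borel"
proof -
  consider "s \<le> 1" | "1 < s" "s < 2" | "2 \<le> s" by linarith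
  then show ?thesis
  proof cases
    case 1
    have "(\<lambda>A. sigma1 A powr s) \<in> borel_measurable borel" by measurable
    with 1 show ?thesis by (simp flip: phi_eq_le_1)
  next
    case 2
    have "(\<lambda>A::mat2. \<bar>det A\<bar> powr (s - 1) * sigma1 A powr (2 - s)) \<in> borel_measurable borel" by measurable
    with 2 show ?thesis by (simp flip: phi_eq_between)
  next
    case 3
    have "(\<lambda>A::mat2. \<bar>det A\<bar> powr (s / 2)) \<in> borel_measurable borel" by measurable
    with 3 show ?thesis by (simp flip: phi_eq_ge_2)
  qed
qed

lemma det_powr_mult:
  fixes A B :: mat2
  shows "\<bar>det (A ** B)\<bar> powr r = \<bar>det A\<bar> powr r * \<bar>det B\<bar> powr r"
  by (simp add: det_mul abs_mult powr_mult)

lemma sigma1_powr_mult_le: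
  assumes "0 \<le> r"
  shows "sigma1 (A ** B) powr r \<le> sigma1 A powr r * sigma1 B powr r"
proof -
  have "sigma1 (A ** B) powr r \<le> (sigma1 A * sigma1 B) powr r"
    using assms by (intro powr_mono2 sigma1_mult_le sigma1_nonneg)
  then show ?thesis
    by (simp add: powr_mult sigma1_nonneg)
qed

lemma phi_mult_le:
  assumes "0 < s"
  shows "phi s (A ** B) \<le> phi s A * phi s B"
proof -
  consider "s \<le> 1" | "1 < s" "s < 2" | "2 \<le> s" by linarith
  then show ?thesis
  proof cases
    case 1
    with assms show ?thesis by (simp add: phi_eq_le_1 sigma1_powr_mult_le)
  next
    case 2
    have "\<bar>det (A ** B)\<bar> powr (s - 1) * sigma1 (A ** B) powr (2 - s)
        \<le> (\<bar>det A\<bar> powr (s - 1) * \<bar>det B\<bar> powr (s - 1)) * (sigma1 A powr (2 - s) * sigma1 B powr (2 - s))"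
      unfolding det_powr_mult using 2 by (intro mult_left_mono sigma1_powr_mult_le) auto
    with 2 show ?thesis by (simp add: phi_eq_between mult_ac)
  next
    case 3
    then show ?thesis by (simp add: phi_eq_ge_2 det_powr_mult)
  qed
qed

lemma phi_nonneg: "0 \<le> phi s A"
  by (simp add: phi_def sigma1_nonneg)

section \<open>Boxes in products of arbitrary measures\<close>

lemma nn_integral_const_mult_indicator:
  assumes "A \<in> sets M"
  shows "(\<integral>\<^sup>+x. c * indicator A x * d \<partial>M) = c * emeasure M A * d"
proof -
  have "(\<integral>\<^sup>+x. c * indicator A x * d \<partial>M) = (\<integral>\<^sup>+x. (c * d) * indicator A x \<partial>M)"
    by (intro nn_integral_cong) (simp add: mult_ac)
  also have "\<dots> = c * d * emeasure M A"
    using assms by (rule nn_integral_cmult_indicator)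
  finally show ?thesis by (simp add: mult_ac)
qed

text \<open>
  Countable additivity of the volume of boxes comes down to this: an identity between
  indicator functions may be integrated over one coordinate after the other. Each
  integration acts on a function of a single variable, so the factors may be arbitrary
  measures. The coefficients \<open>c\<close> and \<open>d k\<close> collect the coordinates that have already been
  integrated out.
\<close>
lemma prod_emeasure_eq_suminf:
  fixes c :: ennreal and d :: "nat \<Rightarrow> ennreal"
  assumes "finite I"
    and "\<And>i. i \<in> I \<Longrightarrow> X i \<in> sets (M i)"
    and "\<And>i k. i \<in> I \<Longrightarrow> Y k i \<in> sets (M i)"
    and "\<And>x. c * (\<Prod>i\<in>I. indicator (X i) (x i)) = (\<Sum>k. d k * (\<Prod>i\<in>I. indicator (Y k i) (x i)))"
  shows "c * (\<Prod>i\<in>I. emeasure (M i) (X i)) = (\<Sum>k. d k * (\<Prod>i\<in>I. emeasure (M i) (Y k i)))"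
  using assms
proof (induction I arbitrary: c d rule: finite_induct)
  case empty
  then show ?case by simp
next
  case (insert j J)
  have "c * emeasure (M j) (X j) * (\<Prod>i\<in>J. indicator (X i) (x i)) =
      (\<Sum>k. d k * emeasure (M j) (Y k j) * (\<Prod>i\<in>J. indicator (Y k i) (x i)))" for x
  proof -
    have upd: "(\<Prod>i\<in>J. indicator (Z i) ((x(j := a)) i)) = (\<Prod>i\<in>J. indicator (Z i) (x i) :: ennreal)" for Z a
      using insert.hyps by (intro prod.cong) auto
    have "c * emeasure (M j) (X j) * (\<Prod>i\<in>J. indicator (X i) (x i)) =
        (\<integral>\<^sup>+a. c * indicator (X j) a * (\<Prod>i\<in>J. indicator (X i) (x i)) \<partial>M j)"
      using insert.prems by (subst nn_integral_const_mult_indicator) auto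
    also have "\<dots> = (\<integral>\<^sup>+a. (\<Sum>k. d k * indicator (Y k j) a * (\<Prod>i\<in>J. indicator (Y k i) (x i))) \<partial>M j)"
      using insert.prems(3)[of "x(j := _)"] insert.hyps upd
      by (intro nn_integral_cong) (simp add: mult.assoc)
    also have "\<dots> = (\<Sum>k. \<integral>\<^sup>+a. d k * indicator (Y k j) a * (\<Prod>i\<in>J. indicator (Y k i) (x i)) \<partial>M j)"
      using insert.prems(2) by (intro nn_integral_suminf) auto
    also have "\<dots> = (\<Sum>k. d k * emeasure (M j) (Y k j) * (\<Prod>i\<in>J. indicator (Y k i) (x i)))"
      using insert.prems by (subst nn_integral_const_mult_indicator) auto
    finally show ?thesis .
  qed
  from insert.IH[OF _ _ this] insert.prems insert.hyps show ?case
    by (simp add: mult.assoc)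
qed

definition boxes :: "'i set \<Rightarrow> ('i \<Rightarrow> 'a measure) \<Rightarrow> ('i \<Rightarrow> 'a) set set" where
  "boxes I M = {Pi\<^sub>E I X | X. \<forall>i\<in>I. X i \<in> sets (M i)}"

text \<open>
  The sides are read off by projecting, which makes the volume a function of the set: the
  empty box can be written with many different families of sides.
\<close>
definition box_volume :: "'i set \<Rightarrow> ('i \<Rightarrow> 'a measure) \<Rightarrow> ('i \<Rightarrow> 'a) set \<Rightarrow> ennreal" where
  "box_volume I M B = (\<Prod>i\<in>I. emeasure (M i) ((\<lambda>x. x i) ` B))"

lemma box_volume_PiE:
  assumes "finite I"
  shows "box_volume I M (Pi\<^sub>E I X) = (\<Prod>i\<in>I. emeasure (M i) (X i))"
proof (cases "Pi\<^sub>E I X = {}")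
  case True
  then obtain i where "i \<in> I" "X i = {}"
    by (auto simp: PiE_eq_empty_iff)
  with assms have "(\<Prod>i\<in>I. emeasure (M i) (X i)) = 0" "card I > 0"
    by (auto simp: card_gt_0_iff intro!: bexI[of _ i])
  moreover from this(2) have "box_volume I M (Pi\<^sub>E I X) = 0"
    by (simp add: box_volume_def True)
  ultimately show ?thesis by simp
next
  case False
  then show ?thesis
    by (simp add: box_volume_def image_projection_PiE)
qed

lemma boxE:
  assumes "B \<in> boxes I M"
  obtains X where "B = Pi\<^sub>E I X" "\<And>i. i \<in> I \<Longrightarrow> X i \<in> sets (M i)"
  using assms by (auto simp: boxes_def)

lemma prod_indicator_eq_indicator_PiE:
  assumes "finite I"
  shows "(\<Prod>i\<in>I. indicator (X i) (x i)) = (indicator (Pi\<^sub>E I X) (restrict x I) :: ennreal)"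
proof (cases "\<forall>i\<in>I. x i \<in> X i")
  case True
  then show ?thesis
    by (simp add: PiE_iff)
next
  case False
  then show ?thesis
    using assms by (auto simp: PiE_iff indicator_def)
qed

lemma box_volume_countably_additive:
  assumes "finite I"
  shows "countably_additive (boxes I M) (box_volume I M)"
proof (rule countably_additiveI)
  fix B :: "nat \<Rightarrow> _"
  assume B: "range B \<subseteq> boxes I M" "disjoint_family B" "\<Union> (range B) \<in> boxes I M"
  have "\<forall>k. \<exists>Y. B k = Pi\<^sub>E I Y \<and> (\<forall>i\<in>I. Y i \<in> sets (M i))"
    using range_subsetD[OF B(1)] by (auto simp: boxes_def)
  then obtain Y where Y: "\<And>k. B k = Pi\<^sub>E I (Y k)" "\<And>k i. i \<in> I \<Longrightarrow> Y k i \<in> sets (M i)"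
    by metis
  from B(3) obtain X where X: "\<Union> (range B) = Pi\<^sub>E I X" "\<And>i. i \<in> I \<Longrightarrow> X i \<in> sets (M i)"
    by (auto elim: boxE)
  have "1 * (\<Prod>i\<in>I. emeasure (M i) (X i)) = (\<Sum>k. 1 * (\<Prod>i\<in>I. emeasure (M i) (Y k i)))"
  proof (rule prod_emeasure_eq_suminf[OF assms X(2) Y(2)])
    fix x
    show "1 * (\<Prod>i\<in>I. indicator (X i) (x i)) = (\<Sum>k. 1 * (\<Prod>i\<in>I. indicator (Y k i) (x i)) :: ennreal)"
      using suminf_indicator[OF B(2), where x="restrict x I"]
      by (simp add: prod_indicator_eq_indicator_PiE[OF assms] X(1)[symmetric] Y(1)[symmetric])
  qed
  then show "(\<Sum>k. box_volume I M (B k)) = box_volume I M (\<Union> (range B))"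
    unfolding X(1) by (simp add: Y(1) box_volume_PiE[OF assms])
qed

text \<open>
  A difference of boxes is cut up according to the set \<open>S\<close> of coordinates at which a point lies
  outside the second box; \<open>S\<close> ranges over the nonempty sets of indices. For an empty index
  set the only box is a singleton, so that the empty set would not be a box.
\<close>
lemma semiring_boxes:
  assumes "finite I" "I \<noteq> {}"
  shows "semiring_of_sets (\<Pi>\<^sub>E i\<in>I. space (M i)) (boxes I M)"
proof
  show "boxes I M \<subseteq> Pow (\<Pi>\<^sub>E i\<in>I. space (M i))"
    using sets.sets_into_space by (auto simp: boxes_def PiE_iff)
  show "{} \<in> boxes I M"
    using assms(2) by (auto simp: boxes_def PiE_eq_empty_iff intro!: exI[of _ "\<lambda>_. {}"])
next
  fix A B assume "A \<in> boxes I M" "B \<in> boxes I M"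
  then obtain X Y where X: "A = Pi\<^sub>E I X" "\<And>i. i \<in> I \<Longrightarrow> X i \<in> sets (M i)"
    and Y: "B = Pi\<^sub>E I Y" "\<And>i. i \<in> I \<Longrightarrow> Y i \<in> sets (M i)"
    by (auto simp: boxes_def)
  show "A \<inter> B \<in> boxes I M"
    using X Y by (auto simp: boxes_def PiE_Int intro!: exI[of _ "\<lambda>i. X i \<inter> Y i"])
  define piece where "piece S = (\<Pi>\<^sub>E i\<in>I. if i \<in> S then X i - Y i else X i \<inter> Y i)" for S
  show "\<exists>C\<subseteq>boxes I M. finite C \<and> disjoint C \<and> A - B = \<Union> C"
  proof (intro exI[of _ "piece ` (Pow I - {{}})"] conjI)
    show "piece ` (Pow I - {{}}) \<subseteq> boxes I M"
      using X Y by (auto simp: boxes_def piece_def)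
    show "finite (piece ` (Pow I - {{}}))"
      using assms by simp
    have uniq: "S = {i\<in>I. x i \<notin> Y i}" if "x \<in> piece S" "S \<subseteq> I" for S x
      using that by (auto simp: piece_def PiE_iff split: if_splits)
    show "disjoint (piece ` (Pow I - {{}}))"
    proof (rule disjointI)
      fix C D assume "C \<in> piece ` (Pow I - {{}})" "D \<in> piece ` (Pow I - {{}})" "C \<noteq> D"
      then obtain S T where "C = piece S" "D = piece T" "S \<subseteq> I" "T \<subseteq> I" "S \<noteq> T"
        by blast
      moreover have "S = T" if "x \<in> piece S" "x \<in> piece T" for x
        using uniq[of x S] uniq[of x T] that \<open>S \<subseteq> I\<close> \<open>T \<subseteq> I\<close> by simp
      ultimately show "C \<inter> D = {}" by auto
    qed
    show "A - B = \<Union> (piece ` (Pow I - {{}}))"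
    proof (intro set_eqI iffI)
      fix x assume "x \<in> A - B"
      then have "x \<in> piece {i\<in>I. x i \<notin> Y i}" "{i\<in>I. x i \<notin> Y i} \<noteq> {}"
        by (auto simp: X Y piece_def PiE_iff)
      then show "x \<in> \<Union> (piece ` (Pow I - {{}}))"
        by (intro UN_I[of "{i\<in>I. x i \<notin> Y i}"]) auto
    next
      fix x assume "x \<in> \<Union> (piece ` (Pow I - {{}}))"
      then obtain S i where S: "S \<subseteq> I" "x \<in> piece S" "i \<in> S"
        by blast
      then have "x i \<notin> Y i" "i \<in> I"
        using uniq[of x S] by auto
      moreover have "x \<in> A"
        using S(2) unfolding X(1) piece_def by (rule subsetD[OF PiE_mono, rotated]) auto
      ultimately show "x \<in> A - B"
        by (auto simp: Y)
    qed
  qed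
qed

text \<open>
  The product measure is by definition some extension of the volume of boxes, if there is one.
  For \<open>\<sigma>\<close>-finite factors an extension is obtained from iterated integrals; for arbitrary
  factors Caratheodory's theorem supplies it. It may fail to be unique; only its
  values on boxes enter below.
\<close>
lemma emeasure_PiM_box:
  assumes "finite I" "\<And>i. i \<in> I \<Longrightarrow> X i \<in> sets (M i)"
  shows "emeasure (Pi\<^sub>M I M) (Pi\<^sub>E I X) = (\<Prod>i\<in>I. emeasure (M i) (X i))"
proof (cases "I = {}")
  case True
  then show ?thesis by (simp add: PiM_empty)
next
  case False
  have sets_eq: "sets (Pi\<^sub>M I M) = sigma_sets (\<Pi>\<^sub>E i\<in>I. space (M i)) (boxes I M)"
  proof -
    have "prod_algebra I M = boxes I M"
      unfolding prod_algebra_eq_finite[OF assms(1)] boxes_def by (auto simp: Pi_iff)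
    then show ?thesis by (simp add: sets_PiM)
  qed
  interpret semiring_of_sets "\<Pi>\<^sub>E i\<in>I. space (M i)" "boxes I M"
    by (rule semiring_boxes[OF assms(1) False])
  have "positive (boxes I M) (box_volume I M)"
    using assms(1) False by (simp add: positive_def box_volume_def card_gt_0_iff)
  then obtain V where V: "\<And>B. B \<in> boxes I M \<Longrightarrow> V B = box_volume I M B"
    "measure_space (\<Pi>\<^sub>E i\<in>I. space (M i)) (sets (Pi\<^sub>M I M)) V"
    using caratheodory box_volume_countably_additive[OF assms(1)] unfolding sets_eq by metis
  \<comment> \<open>A cylinder over \<open>J\<close> is the box whose remaining sides are full spaces.\<close>
  let ?full = "\<lambda>J X i. if i \<in> J then X i else space (M i)"
  have emb: "prod_emb I M J (Pi\<^sub>E J X) = Pi\<^sub>E I (?full J X)"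
    if "J \<subseteq> I" "X \<in> (\<Pi> j\<in>J. sets (M j))" for J X
    using that sets.sets_into_space[of _ "M _"] by (intro prod_emb_PiE) (blast dest: Pi_mem)+
  let ?idx = "{(J, X). (J \<noteq> {} \<or> I = {}) \<and> finite J \<and> J \<subseteq> I \<and> X \<in> (\<Pi> j\<in>J. sets (M j))}"
  have "emeasure (Pi\<^sub>M I M) ((\<lambda>(J, X). prod_emb I M J (Pi\<^sub>E J X)) (I, X)) =
    (\<lambda>(J, X). \<Prod>j\<in>J \<union> {i\<in>I. emeasure (M i) (space (M i)) \<noteq> 1}.
        if j \<in> J then emeasure (M j) (X j) else emeasure (M j) (space (M j))) (I, X)"
  proof (rule emeasure_extend_measure[OF PiM_def, where \<mu>' = V])
    show "(\<lambda>(J, X). prod_emb I M J (Pi\<^sub>E J X)) ` ?idx \<subseteq> Pow (\<Pi>\<^sub>E i\<in>I. space (M i))"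
      by (auto simp: prod_emb_def)
    show "positive (sets (Pi\<^sub>M I M)) V" "countably_additive (sets (Pi\<^sub>M I M)) V"
      using V(2) by (auto simp: measure_space_def)
    show "(I, X) \<in> ?idx" using assms by auto
  next
    fix JX assume "JX \<in> ?idx"
    then obtain J X where JX: "JX = (J, X)" "finite J" "J \<subseteq> I" "X \<in> (\<Pi> j\<in>J. sets (M j))"
      by auto
    then have "Pi\<^sub>E I (?full J X) \<in> boxes I M"
      by (auto simp: boxes_def Pi_iff intro!: exI[of _ "?full J X"])
    then have "V (prod_emb I M J (Pi\<^sub>E J X)) = (\<Prod>i\<in>I. emeasure (M i) (?full J X i))"
      using JX by (simp add: V(1) emb box_volume_PiE[OF assms(1)])
    also have "\<dots> = (\<Prod>j\<in>J \<union> {i\<in>I. emeasure (M i) (space (M i)) \<noteq> 1}.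
        if j \<in> J then emeasure (M j) (X j) else emeasure (M j) (space (M j)))"
      using JX(3) assms(1) by (intro prod.mono_neutral_cong_right) auto
    finally show "V ((\<lambda>(J, X). prod_emb I M J (Pi\<^sub>E J X)) JX) =
        (\<lambda>(J, X). \<Prod>j\<in>J \<union> {i\<in>I. emeasure (M i) (space (M i)) \<noteq> 1}.
        if j \<in> J then emeasure (M j) (X j) else emeasure (M j) (space (M j))) JX"
      using JX(1) by simp
  qed
  moreover have "prod_emb I M I (Pi\<^sub>E I X) = Pi\<^sub>E I X"
    using assms(2) sets.sets_into_space by (subst prod_emb_PiE) (auto intro!: PiE_cong)
  moreover have "I \<union> {i\<in>I. emeasure (M i) (space (M i)) \<noteq> 1} = I" by auto
  ultimately show ?thesis by (simp cong: prod.cong)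
qed

section \<open>Multiplicative powers of a measure on matrices\<close>

lemma borel_measurable_matrix_mult [measurable (raw)]:
  fixes f g :: "'a \<Rightarrow> mat2"
  assumes "f \<in> borel_measurable M" "g \<in> borel_measurable M"
  shows "(\<lambda>x. f x ** g x) \<in> borel_measurable M"
proof (rule borel_measurable_continuous_Pair[OF assms])
  show "continuous_on UNIV (\<lambda>x::mat2 \<times> mat2. fst x ** snd x)"
    unfolding matrix_matrix_mult_def
    by (intro continuous_on_vec_lambda continuous_on_sum continuous_on_mult continuous_on_component
        continuous_on_fst continuous_on_snd continuous_on_id)
qed

lemma mat_product_0: "mat_product 0 A = mat 1"
  by (simp add: mat_product_def)

lemma foldr_matrix_mult: "foldr (**) As B = foldr (**) As (mat 1) ** (B :: mat2)"
  by (induction As) (simp_all flip: matrix_mul_assoc)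

lemma mat_product_Suc: "mat_product (Suc n) A = mat_product n A ** A (Suc n)"
  unfolding mat_product_def by (simp add: foldr_matrix_mult[of _ "A (Suc n)"])

lemma mat_product_cong:
  assumes "\<And>i. 1 \<le> i \<Longrightarrow> i \<le> n \<Longrightarrow> A i = B i"
  shows "mat_product n A = mat_product n B"
  unfolding mat_product_def using assms by (intro arg_cong[where f = "\<lambda>l. foldr _ l _"] map_cong) auto

lemma measurable_mat_product:
  assumes "sets M = sets borel" "{1..n} \<subseteq> I"
  shows "mat_product n \<in> borel_measurable (Pi\<^sub>M I (\<lambda>_. M))"
  using assms(2)
proof (induction n)
  case 0
  then show ?case by (simp add: mat_product_0)
next
  case (Suc n)
  have "(\<lambda>x. x (Suc n)) \<in> measurable (Pi\<^sub>M I (\<lambda>_. M)) M"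
    using Suc.prems by (intro measurable_component_singleton) auto
  then have "(\<lambda>x. x (Suc n)) \<in> borel_measurable (Pi\<^sub>M I (\<lambda>_. M))"
    using measurable_cong_sets[OF refl assms(1)] by blast
  moreover have "mat_product n \<in> borel_measurable (Pi\<^sub>M I (\<lambda>_. M))"
    by (intro Suc.IH order_trans[OF _ Suc.prems]) auto
  ultimately show ?case
    unfolding mat_product_Suc by measurable
qed

lemma nn_integral_mu_pow:
  assumes "sets M = sets borel" "g \<in> borel_measurable borel"
  shows "(\<integral>\<^sup>+X. g X \<partial>mu_pow M n) = (\<integral>\<^sup>+x. g (mat_product n x) \<partial>Pi\<^sub>M {1..n} (\<lambda>_. M))"
  unfolding mu_pow_def using measurable_mat_product[OF assms(1), of n "{1..n}"] assms(2)
  by (intro nn_integral_distr) auto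

lemma sets_mu_pow [simp, measurable_cong]: "sets (mu_pow M n) = sets borel"
  by (simp add: mu_pow_def)

lemma nn_integral_mu_pow_0:
  assumes "sets M = sets borel" "g \<in> borel_measurable borel"
  shows "(\<integral>\<^sup>+X. g X \<partial>mu_pow M 0) = g (mat 1)"
  using assms by (simp add: nn_integral_mu_pow PiM_empty mat_product_0 nn_integral_count_space_finite)

text \<open>
  For a \<open>\<sigma>\<close>-finite measure Fubini's theorem turns the image of a product measure under matrix
  multiplication into an iterated integral, and associativity of the product makes the
  powers of the measure behave like powers in a semigroup.
\<close>
locale sigma_finite_mat2 = sigma_finite_measure M for M :: "mat2 measure" +
  assumes sets_eq: "sets M = sets borel"
begin

sublocale product: product_sigma_finite "\<lambda>_::nat. M"
  by standard

lemma nn_integral_mu_pow_Suc: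
  assumes [measurable]: "g \<in> borel_measurable borel"
  shows "(\<integral>\<^sup>+X. g X \<partial>mu_pow M (Suc n)) = (\<integral>\<^sup>+A. (\<integral>\<^sup>+X. g (X ** A) \<partial>mu_pow M n) \<partial>M)"
proof -
  have idx: "{1..Suc n} = insert (Suc n) {1..n}" by auto
  have [measurable]: "mat_product (Suc n) \<in> borel_measurable (Pi\<^sub>M (insert (Suc n) {1..n}) (\<lambda>_. M))"
    by (intro measurable_mat_product sets_eq) auto
  have "(\<integral>\<^sup>+X. g X \<partial>mu_pow M (Suc n)) =
      (\<integral>\<^sup>+A. (\<integral>\<^sup>+x. g (mat_product (Suc n) (x(Suc n := A))) \<partial>Pi\<^sub>M {1..n} (\<lambda>_. M)) \<partial>M)"
    unfolding nn_integral_mu_pow[OF sets_eq assms] idx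
    by (rule product.product_nn_integral_insert_rev) auto
  also have "\<dots> = (\<integral>\<^sup>+A. (\<integral>\<^sup>+x. g (mat_product n x ** A) \<partial>Pi\<^sub>M {1..n} (\<lambda>_. M)) \<partial>M)"
  proof -
    have "mat_product n (x(Suc n := A)) = mat_product n x" for x A
      by (intro mat_product_cong) auto
    then show ?thesis by (simp add: mat_product_Suc)
  qed
  also have "\<dots> = (\<integral>\<^sup>+A. (\<integral>\<^sup>+X. g (X ** A) \<partial>mu_pow M n) \<partial>M)"
    by (subst nn_integral_mu_pow[OF sets_eq]) auto
  finally show ?thesis .
qed

lemma nn_integral_mu_pow_1:
  assumes "g \<in> borel_measurable borel"
  shows "(\<integral>\<^sup>+X. g X \<partial>mu_pow M 1) = (\<integral>\<^sup>+A. g A \<partial>M)"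
  unfolding One_nat_def nn_integral_mu_pow_Suc[OF assms] using assms
  by (subst nn_integral_mu_pow_0[OF sets_eq]) auto

lemma nn_integral_mu_pow_2:
  assumes [measurable]: "g \<in> borel_measurable borel"
  shows "(\<integral>\<^sup>+X. g X \<partial>mu_pow M 2) = (\<integral>\<^sup>+A. (\<integral>\<^sup>+X. g (X ** A) \<partial>M) \<partial>M)"
  using nn_integral_mu_pow_Suc[OF assms, of 1] nn_integral_mu_pow_1[of "\<lambda>X. g (X ** _)"]
  by (simp add: Suc_1)

lemma borel_measurable_nn_integral_mu_pow:
  assumes "(\<lambda>(X, y). h X y) \<in> borel_measurable (borel \<Otimes>\<^sub>M N)"
  shows "(\<lambda>y. \<integral>\<^sup>+X. h X y \<partial>mu_pow M n) \<in> borel_measurable N"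
proof -
  have [measurable]: "mat_product n \<in> borel_measurable (Pi\<^sub>M {1..n} (\<lambda>_. M))"
    by (intro measurable_mat_product sets_eq) auto
  interpret P: sigma_finite_measure "Pi\<^sub>M {1..n} (\<lambda>_. M)"
    by (rule product.sigma_finite) auto
  have [measurable]: "(\<lambda>X. h X y) \<in> borel_measurable borel" if "y \<in> space N" for y
    using measurable_compose[OF measurable_Pair2'[OF that] assms] by simp
  have "(\<lambda>z. (mat_product n (snd z), fst z)) \<in> N \<Otimes>\<^sub>M Pi\<^sub>M {1..n} (\<lambda>_. M) \<rightarrow>\<^sub>M borel \<Otimes>\<^sub>M N"
    by measurable
  from measurable_compose[OF this assms]
  have "(\<lambda>y. \<integral>\<^sup>+x. h (mat_product n x) y \<partial>Pi\<^sub>M {1..n} (\<lambda>_. M)) \<in> borel_measurable N"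
    by (intro P.borel_measurable_nn_integral) (simp add: split_beta)
  then show ?thesis
    by (subst measurable_cong[OF nn_integral_mu_pow[OF sets_eq]]) auto
qed

lemma nn_integral_mu_pow_add:
  assumes [measurable]: "g \<in> borel_measurable borel"
  shows "(\<integral>\<^sup>+X. g X \<partial>mu_pow M (m + n)) = (\<integral>\<^sup>+Y. (\<integral>\<^sup>+X. g (X ** Y) \<partial>mu_pow M m) \<partial>mu_pow M n)"
  using assms
proof (induction n arbitrary: g)
  case 0
  note [measurable] = 0
  have "(\<lambda>Y. \<integral>\<^sup>+X. g (X ** Y) \<partial>mu_pow M m) \<in> borel_measurable borel"
    by (intro borel_measurable_nn_integral_mu_pow) measurable
  then show ?case
    by (subst nn_integral_mu_pow_0[OF sets_eq]) auto
next
  case (Suc n)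
  note [measurable] = Suc.prems
  have meas: "(\<lambda>Y. \<integral>\<^sup>+X. g (X ** Y) \<partial>mu_pow M m) \<in> borel_measurable borel"
    by (intro borel_measurable_nn_integral_mu_pow) measurable
  have "(\<integral>\<^sup>+X. g X \<partial>mu_pow M (m + Suc n)) =
      (\<integral>\<^sup>+A. (\<integral>\<^sup>+X. g (X ** A) \<partial>mu_pow M (m + n)) \<partial>M)"
    by (simp add: nn_integral_mu_pow_Suc[OF Suc.prems])
  also have "\<dots> = (\<integral>\<^sup>+A. (\<integral>\<^sup>+Y. (\<integral>\<^sup>+X. g (X ** (Y ** A)) \<partial>mu_pow M m) \<partial>mu_pow M n) \<partial>M)"
    by (subst Suc.IH) (auto simp: matrix_mul_assoc)
  also have "\<dots> = (\<integral>\<^sup>+Y. (\<integral>\<^sup>+X. g (X ** Y) \<partial>mu_pow M m) \<partial>mu_pow M (Suc n))"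
    by (rule nn_integral_mu_pow_Suc[OF meas, symmetric])
  finally show ?case .
qed

lemma nn_integral_mu_pow_submult:
  assumes [measurable]: "g \<in> borel_measurable borel" and "\<And>X Y. g (X ** Y) \<le> g X * g Y"
  shows "(\<integral>\<^sup>+X. g X \<partial>mu_pow M (m + n)) \<le> (\<integral>\<^sup>+X. g X \<partial>mu_pow M m) * (\<integral>\<^sup>+X. g X \<partial>mu_pow M n)"
proof -
  have "(\<integral>\<^sup>+X. g X \<partial>mu_pow M (m + n)) \<le> (\<integral>\<^sup>+Y. (\<integral>\<^sup>+X. g X * g Y \<partial>mu_pow M m) \<partial>mu_pow M n)"
    unfolding nn_integral_mu_pow_add[OF assms(1)] by (intro nn_integral_mono assms(2))
  also have "\<dots> = (\<integral>\<^sup>+X. g X \<partial>mu_pow M m) * (\<integral>\<^sup>+X. g X \<partial>mu_pow M n)"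
    by (simp add: nn_integral_multc nn_integral_cmult)
  finally show ?thesis .
qed

end

text \<open>
  For a submultiplicative integrand a product of matrices contributes only if each of its
  factors does. So the part of the measure that lives where \<open>g\<close> vanishes may be discarded. For
  integrable \<open>g\<close> this is the only part on which \<open>\<sigma>\<close>-finiteness can fail.
\<close>
lemma mat_product_nonzero:
  fixes g :: "mat2 \<Rightarrow> ennreal"
  assumes "\<And>X Y. g (X ** Y) \<le> g X * g Y" "g (mat_product n x) \<noteq> 0" "i \<in> {1..n}"
  shows "g (x i) \<noteq> 0"
  using assms(2,3)
proof (induction n)
  case (Suc n)
  then have "g (mat_product n x) * g (x (Suc n)) \<noteq> 0"
    using assms(1)[of "mat_product n x" "x (Suc n)"] by (auto simp: mat_product_Suc)
  with Suc show ?case by (cases "i = Suc n") auto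
qed simp

definition nonvanishing_part :: "mat2 measure \<Rightarrow> (mat2 \<Rightarrow> ennreal) \<Rightarrow> mat2 measure" where
  "nonvanishing_part M g = density M (indicator {A. g A \<noteq> 0})"

lemma sets_nonvanishing_part [simp]: "sets (nonvanishing_part M g) = sets M"
  by (simp add: nonvanishing_part_def)

lemma sigma_finite_nonvanishing_part:
  assumes "sets M = sets borel" and [measurable]: "g \<in> borel_measurable borel"
    and fin: "(\<integral>\<^sup>+A. g A \<partial>M) < \<infinity>"
  shows "sigma_finite_measure (nonvanishing_part M g)"
proof
  note [measurable_cong] = assms(1)
  let ?N = "nonvanishing_part M g"
  have emeasure_eq: "emeasure ?N B = emeasure M ({A. g A \<noteq> 0} \<inter> B)" if [measurable]: "B \<in> sets borel" for B
    unfolding nonvanishing_part_def using that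
    by (intro emeasure_restricted) (auto simp: assms(1))
  \<comment> \<open>By Markov's inequality these sets have finite measure; together with the zero set of \<open>g\<close>, which is null, they cover the space.\<close>
  let ?C = "\<lambda>n::nat. {A. 1 \<le> of_nat n * g A}"
  have fin_C: "emeasure ?N (?C n) \<noteq> \<infinity>" for n
  proof -
    have "emeasure ?N (?C n) \<le> emeasure M (?C n)"
      by (subst emeasure_eq) (auto intro!: emeasure_mono simp: assms(1))
    also have "\<dots> \<le> of_nat n * (\<integral>\<^sup>+A. g A \<partial>M)"
      using nn_integral_Markov_inequality[of g UNIV M "of_nat n"] sets_eq_imp_space_eq[OF assms(1)]
      by (simp add: assms(1))
    also have "\<dots> < \<infinity>"
      using fin by (simp add: ennreal_mult_less_top of_nat_less_top)
    finally show ?thesis by simp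
  qed
  have null: "emeasure ?N {A. g A = 0} = 0"
    by (subst emeasure_eq) (auto simp: Int_def)
  have cover: "\<exists>n. 1 \<le> of_nat n * g A" if "g A \<noteq> 0" for A
  proof -
    have "1 \<le> of_nat 1 * g A" if "g A = \<infinity>"
      using that by simp
    moreover have "\<exists>n. 1 \<le> of_nat n * g A" if r: "g A = ennreal r" "0 < r" for r
    proof -
      obtain n where "1 / r \<le> real n"
        using real_arch_simple by blast
      then have "1 \<le> real n * r"
        using r(2) by (simp add: field_simps)
      then have "ennreal 1 \<le> ennreal (real n * r)"
        by (rule ennreal_leI)
      then show ?thesis
        using r by (auto simp: ennreal_mult ennreal_of_nat_eq_real_of_nat)
    qed
    moreover have "0 < r" if "g A = ennreal r" for r
      using that \<open>g A \<noteq> 0\<close> by (metis ennreal_eq_0_iff not_less)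
    ultimately show ?thesis
      by (cases "g A") (metis, metis infinity_ennreal_def)
  qed
  show "\<exists>B. countable B \<and> B \<subseteq> sets ?N \<and> \<Union> B = space ?N \<and> (\<forall>b\<in>B. emeasure ?N b \<noteq> \<infinity>)"
  proof (intro exI[of _ "insert {A. g A = 0} (range ?C)"] conjI)
    show "\<Union> (insert {A. g A = 0} (range ?C)) = space ?N"
      using cover sets_eq_imp_space_eq[OF assms(1)] by (auto simp: nonvanishing_part_def)
  qed (use fin_C null in \<open>auto simp: assms(1)\<close>)
qed

text \<open>
  The product measure cut down to a power of $\{g\ne0\}$ gives boxes the same volume as the
  product of the cut down measures. The latter are \<open>\<sigma>\<close>-finite, where values on boxes determine
  the measure.
\<close>
lemma nn_integral_mu_pow_nonvanishing_part:
  assumes "sets M = sets borel" and [measurable]: "g \<in> borel_measurable borel"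
    and submult: "\<And>X Y. g (X ** Y) \<le> g X * g Y" and fin: "(\<integral>\<^sup>+A. g A \<partial>M) < \<infinity>"
  shows "(\<integral>\<^sup>+X. g X \<partial>mu_pow M n) = (\<integral>\<^sup>+X. g X \<partial>mu_pow (nonvanishing_part M g) n)"
proof -
  note [measurable_cong] = assms(1)
  let ?N = "nonvanishing_part M g" and ?P = "Pi\<^sub>M {1..n} (\<lambda>_. M)"
  define E where "E = {A. g A \<noteq> 0}"
  have [measurable]: "E \<in> sets M" "E \<in> sets borel"
    by (auto simp: E_def assms(1))
  have N: "sets ?N = sets borel" by (simp add: assms(1))
  interpret sigma_finite_mat2 ?N
    using sigma_finite_nonvanishing_part[OF assms(1,2) fin] N
    by (simp add: sigma_finite_mat2_def sigma_finite_mat2_axioms_def)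
  have [measurable]: "mat_product n \<in> borel_measurable ?P"
    by (intro measurable_mat_product assms(1)) auto
  let ?E = "\<Pi>\<^sub>E i\<in>{1..n}. E"
  have box[measurable]: "?E \<in> sets ?P"
    by (intro sets_PiM_I_finite) auto
  have emeasure_N: "emeasure ?N B = emeasure M (E \<inter> B)" if [measurable]: "B \<in> sets M" for B
    unfolding nonvanishing_part_def E_def[symmetric]
    by (intro emeasure_restricted) auto
  have "density ?P (indicator ?E) = Pi\<^sub>M {1..n} (\<lambda>_. ?N)"
  proof (rule product.PiM_eqI)
    show "sets (density ?P (indicator ?E)) = sets (Pi\<^sub>M {1..n} (\<lambda>_. ?N))"
      by (simp cong: sets_PiM_cong)
    fix B :: "nat \<Rightarrow> mat2 set" assume "\<And>i. i \<in> {1..n} \<Longrightarrow> B i \<in> sets ?N"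
    then have B: "B i \<in> sets M" if "i \<in> {1..n}" for i using that by simp
    then have [measurable]: "Pi\<^sub>E {1..n} B \<in> sets ?P"
      by (intro sets_PiM_I_finite) auto
    have "emeasure (density ?P (indicator ?E)) (Pi\<^sub>E {1..n} B) = emeasure ?P (?E \<inter> Pi\<^sub>E {1..n} B)"
      by (intro emeasure_restricted) auto
    also have "\<dots> = (\<Prod>i\<in>{1..n}. emeasure M (E \<inter> B i))"
      unfolding PiE_Int using B by (intro emeasure_PiM_box) auto
    also have "\<dots> = (\<Prod>i\<in>{1..n}. emeasure ?N (B i))"
      using B by (intro prod.cong) (auto simp: emeasure_N)
    finally show "emeasure (density ?P (indicator ?E)) (Pi\<^sub>E {1..n} B) = (\<Prod>i\<in>{1..n}. emeasure ?N (B i))" .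
  qed simp
  then have "(\<integral>\<^sup>+X. g X \<partial>mu_pow ?N n) = (\<integral>\<^sup>+x. g (mat_product n x) \<partial>density ?P (indicator ?E))"
    by (simp add: nn_integral_mu_pow[OF N])
  also have "\<dots> = (\<integral>\<^sup>+x. indicator ?E x * g (mat_product n x) \<partial>?P)"
    by (subst nn_integral_density) auto
  also have "\<dots> = (\<integral>\<^sup>+x. g (mat_product n x) \<partial>?P)"
  proof (intro nn_integral_cong)
    fix x assume "x \<in> space ?P"
    then have "x \<in> ?E" if "g (mat_product n x) \<noteq> 0"
      using mat_product_nonzero[where g = g, OF submult that] by (auto simp: space_PiM PiE_iff E_def)
    then show "indicator ?E x * g (mat_product n x) = g (mat_product n x)"
      by (cases "g (mat_product n x) = 0") auto
  qed
  also have "\<dots> = (\<integral>\<^sup>+X. g X \<partial>mu_pow M n)"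
    by (simp add: nn_integral_mu_pow[OF assms(1)])
  finally show ?thesis by simp
qed

section \<open>Powers of the Euclidean norm in the plane\<close>

text \<open>
  Concavity: each of the two fractions $a/(a+b)$ and $b/(a+b)$ lies in $[0,1]$ and is at most its
  own power with exponent \<open>t\<close>.
\<close>
lemma powr_add_le:
  fixes a b t :: real
  assumes "0 \<le> a" "0 \<le> b" "0 < t" "t \<le> 1"
  shows "(a + b) powr t \<le> a powr t + b powr t"
proof (cases "a + b = 0")
  case False
  with assms have pos: "0 < a + b" by simp
  have "x / (a + b) \<le> (x / (a + b)) powr t" if "0 \<le> x" "x \<le> a + b" for x
  proof (cases "x = 0")
    case False
    with that pos have "0 < x / (a + b)" "x / (a + b) \<le> 1" by auto
    then have "(x / (a + b)) powr 1 \<le> (x / (a + b)) powr t"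
      using assms by (intro powr_mono') auto
    with \<open>0 < x / (a + b)\<close> show ?thesis by (simp only: powr_one)
  qed simp
  then have "a / (a + b) + b / (a + b) \<le> (a / (a + b)) powr t + (b / (a + b)) powr t"
    using assms by (intro add_mono) auto
  then have "1 \<le> (a / (a + b)) powr t + (b / (a + b)) powr t"
    using pos by (simp flip: add_divide_distrib)
  then have "1 \<le> (a powr t + b powr t) / (a + b) powr t"
    using assms by (simp add: powr_divide add_divide_distrib)
  with pos show ?thesis
    by (simp add: pos_le_divide_eq)
qed (use assms in auto)

definition perp :: "real^2 \<Rightarrow> real^2" where
  "perp e = vector [- (e$2), e$1]"

lemma norm_perp: "norm (perp e) = norm e"
  by (simp add: norm_eq_sqrt_inner inner_vec_def sum_2 perp_def)

lemma perp_expansion: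
  assumes "norm e = 1"
  shows "v = inner e v *\<^sub>R e + inner (perp e) v *\<^sub>R perp e"
proof -
  have "e$1 * e$1 + e$2 * e$2 = 1"
    using assms by (simp add: norm_eq_sqrt_inner inner_vec_def sum_2)
  then show ?thesis
    unfolding vec_eq_iff forall_2 inner_vec_def sum_2 perp_def by simp algebra
qed

lemma borel_measurable_matrix_vector_mult [measurable (raw)]:
  fixes f :: "'a \<Rightarrow> mat2"
  assumes "f \<in> borel_measurable M"
  shows "(\<lambda>x. f x *v v) \<in> borel_measurable M"
proof (rule measurable_compose[OF assms], rule borel_measurable_continuous_onI)
  show "continuous_on UNIV (\<lambda>A::mat2. A *v v)"
    unfolding matrix_vector_mult_def
    by (intro continuous_on_vec_lambda continuous_on_sum continuous_on_mult continuous_on_component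
        continuous_on_const continuous_on_id)
qed

definition norm_powr :: "real \<Rightarrow> real^2 \<Rightarrow> ennreal" where
  "norm_powr t v = ennreal (norm v powr t)"

lemma borel_measurable_norm_powr [measurable]: "norm_powr t \<in> borel_measurable borel"
  unfolding norm_powr_def by measurable

lemma norm_powr_scaleR: "norm_powr t (c *\<^sub>R v) = ennreal (\<bar>c\<bar> powr t) * norm_powr t v"
  by (simp add: norm_powr_def powr_mult ennreal_mult)

lemma norm_powr_add:
  assumes "0 < t" "t \<le> 1"
  shows "norm_powr t (u + v) \<le> norm_powr t u + norm_powr t v"
proof -
  have "norm (u + v) powr t \<le> (norm u + norm v) powr t"
    using assms by (intro powr_mono2 norm_triangle_ineq) auto
  also have "\<dots> \<le> norm u powr t + norm v powr t"
    using assms by (intro powr_add_le) auto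
  finally show ?thesis
    unfolding norm_powr_def by (simp flip: ennreal_plus add: ennreal_leI)
qed

lemma norm_powr_matrix_vector_le:
  assumes "0 < t"
  shows "norm_powr t (A *v v) \<le> ennreal (sigma1 A powr t) * norm_powr t v"
proof -
  have "norm (A *v v) powr t \<le> (sigma1 A * norm v) powr t"
    using assms by (intro powr_mono2 norm_matrix_vector_le_sigma1) auto
  then show ?thesis
    unfolding norm_powr_def using sigma1_nonneg[of A]
    by (simp flip: ennreal_mult add: powr_mult ennreal_leI)
qed

text \<open>
  The norm of a matrix is bounded by the sum of the norms of its columns in the orthonormal
  basis \<open>e\<close>, \<open>perp e\<close>.
\<close>
lemma sigma1_powr_le_norm_powr:
  assumes "0 < t" "t \<le> 1" "norm e = 1"
  shows "ennreal (sigma1 B powr t) \<le> norm_powr t (B *v e) + norm_powr t (B *v perp e)"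
proof -
  have "sigma1 B \<le> norm (B *v e) + norm (B *v perp e)"
  proof (rule sigma1_le)
    fix v
    have "B *v v = inner e v *\<^sub>R (B *v e) + inner (perp e) v *\<^sub>R (B *v perp e)"
      by (subst perp_expansion[OF assms(3), of v])
        (simp add: matrix_vector_right_distrib matrix_vector_mult_scaleR)
    then have "norm (B *v v) \<le> \<bar>inner e v\<bar> * norm (B *v e) + \<bar>inner (perp e) v\<bar> * norm (B *v perp e)"
      using norm_triangle_ineq[of "inner e v *\<^sub>R (B *v e)" "inner (perp e) v *\<^sub>R (B *v perp e)"] by simp
    also have "\<dots> \<le> norm v * norm (B *v e) + norm v * norm (B *v perp e)"
      using Cauchy_Schwarz_ineq2[of e v] Cauchy_Schwarz_ineq2[of "perp e" v] assms(3)
      by (intro add_mono mult_right_mono) (auto simp: norm_perp)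
    finally show "norm (B *v v) \<le> (norm (B *v e) + norm (B *v perp e)) * norm v"
      by (simp add: algebra_simps)
  qed
  then have "sigma1 B powr t \<le> (norm (B *v e) + norm (B *v perp e)) powr t"
    using assms sigma1_nonneg[of B] by (intro powr_mono2) auto
  also have "\<dots> \<le> norm (B *v e) powr t + norm (B *v perp e) powr t"
    using assms by (intro powr_add_le) auto
  finally show ?thesis
    unfolding norm_powr_def by (simp flip: ennreal_plus add: ennreal_leI)
qed

section \<open>A norm adapted to the averaged action on the plane\<close>

text \<open>
  A common form of \<^term>\<open>phi s\<close> for all \<open>s < 2\<close>: a multiplicative weight \<open>W\<close> times a power of the norm
  with exponent $t\in(0,1]$. The restriction on the exponent makes $|v|^t$ subadditive.
\<close>
locale weighted_norm = sigma_finite_mat2 +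
  fixes W :: "mat2 \<Rightarrow> ennreal" and t :: real
  assumes W_measurable [measurable]: "W \<in> borel_measurable borel"
    and W_mult: "W (A ** B) = W A * W B"
    and W_one: "W (mat 1) = 1"
    and t_pos: "0 < t" and t_le_1: "t \<le> 1"
begin

definition wnorm :: "mat2 \<Rightarrow> ennreal" where
  "wnorm A = W A * ennreal (sigma1 A powr t)"

lemma wnorm_measurable [measurable]: "wnorm \<in> borel_measurable borel"
  unfolding wnorm_def by measurable

definition orbit_integral :: "nat \<Rightarrow> real^2 \<Rightarrow> ennreal" where
  "orbit_integral k v = (\<integral>\<^sup>+X. W X * norm_powr t (X *v v) \<partial>mu_pow M k)"

lemma orbit_integral_0: "orbit_integral 0 v = norm_powr t v"
  unfolding orbit_integral_def by (subst nn_integral_mu_pow_0[OF sets_eq]) (auto simp: W_one)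

lemma orbit_integral_measurable [measurable]:
  fixes v :: "real^2"
  shows "(\<lambda>A. orbit_integral k (A *v v)) \<in> borel_measurable borel"
proof -
  have "(\<lambda>(X, A). W X * norm_powr t ((X ** A) *v v)) \<in> borel_measurable (borel \<Otimes>\<^sub>M borel)"
    by measurable
  then show ?thesis
    unfolding orbit_integral_def matrix_vector_mul_assoc
    by (rule borel_measurable_nn_integral_mu_pow)
qed

lemma orbit_integral_Suc:
  "orbit_integral (Suc k) v = (\<integral>\<^sup>+A. W A * orbit_integral k (A *v v) \<partial>M)"
proof -
  have "orbit_integral (Suc k) v =
      (\<integral>\<^sup>+A. (\<integral>\<^sup>+X. W A * (W X * norm_powr t (X *v (A *v v))) \<partial>mu_pow M k) \<partial>M)"
    unfolding orbit_integral_def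
    by (subst nn_integral_mu_pow_Suc) (auto simp: W_mult matrix_vector_mul_assoc mult_ac)
  also have "\<dots> = (\<integral>\<^sup>+A. W A * orbit_integral k (A *v v) \<partial>M)"
    unfolding orbit_integral_def by (subst nn_integral_cmult) auto
  finally show ?thesis .
qed

lemma orbit_integral_scaleR:
  "orbit_integral k (c *\<^sub>R v) = ennreal (\<bar>c\<bar> powr t) * orbit_integral k v"
  unfolding orbit_integral_def
  by (subst nn_integral_cmult[symmetric])
    (auto simp: matrix_vector_mult_scaleR norm_powr_scaleR mult_ac)

lemma orbit_integral_add: "orbit_integral k (u + v) \<le> orbit_integral k u + orbit_integral k v"
proof -
  have "orbit_integral k (u + v) \<le>
      (\<integral>\<^sup>+X. W X * norm_powr t (X *v u) + W X * norm_powr t (X *v v) \<partial>mu_pow M k)"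
    unfolding orbit_integral_def matrix_vector_right_distrib distrib_left[symmetric]
    by (intro nn_integral_mono mult_left_mono norm_powr_add t_pos t_le_1) auto
  also have "\<dots> = orbit_integral k u + orbit_integral k v"
    unfolding orbit_integral_def by (intro nn_integral_add) measurable
  finally show ?thesis .
qed

lemma orbit_integral_le:
  "orbit_integral k v \<le> (\<integral>\<^sup>+X. wnorm X \<partial>mu_pow M k) * norm_powr t v"
proof -
  have "orbit_integral k v \<le> (\<integral>\<^sup>+X. wnorm X * norm_powr t v \<partial>mu_pow M k)"
    unfolding orbit_integral_def wnorm_def mult.assoc
    by (intro nn_integral_mono mult_left_mono norm_powr_matrix_vector_le t_pos) auto
  also have "\<dots> = (\<integral>\<^sup>+X. wnorm X \<partial>mu_pow M k) * norm_powr t v"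
    by (intro nn_integral_multc) measurable
  finally show ?thesis .
qed

text \<open>
  For suitable \<open>y\<close> and \<open>m\<close> the averaged action of the random matrix multiplies this function by at
  most \<open>y\<close>. It is the truncation of the series $\sum_k y^{-k}T^k|v|^t$, where $(Tf)(v)=\int W(A)f(Av)\,dM(A)$ and
  \<^term>\<open>orbit_integral k v\<close> is $T^k|v|^t$.
\<close>
definition adapted_norm :: "real \<Rightarrow> nat \<Rightarrow> real^2 \<Rightarrow> ennreal" where
  "adapted_norm y m v = (\<Sum>k<m. ennreal (inverse y ^ k) * orbit_integral k v)"

lemma adapted_norm_measurable [measurable]:
  fixes v :: "real^2"
  shows "(\<lambda>A. adapted_norm y m (A *v v)) \<in> borel_measurable borel"
  unfolding adapted_norm_def by measurable

lemma adapted_norm_scaleR: "adapted_norm y m (c *\<^sub>R v) = ennreal (\<bar>c\<bar> powr t) * adapted_norm y m v"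
  unfolding adapted_norm_def orbit_integral_scaleR sum_distrib_left by (simp add: mult_ac)

lemma adapted_norm_add: "adapted_norm y m (u + v) \<le> adapted_norm y m u + adapted_norm y m v"
  unfolding adapted_norm_def sum.distrib[symmetric] distrib_left[symmetric]
  by (intro sum_mono mult_left_mono orbit_integral_add) auto

lemma norm_powr_le_adapted_norm:
  assumes "1 \<le> m"
  shows "norm_powr t v \<le> adapted_norm y m v"
proof -
  obtain m' where "m = Suc m'"
    using assms by (cases m) auto
  then show ?thesis
    unfolding adapted_norm_def by (simp add: sum.lessThan_Suc_shift orbit_integral_0 del: sum.lessThan_Suc)
qed

lemma adapted_norm_finite:
  assumes "\<And>k. (\<integral>\<^sup>+X. wnorm X \<partial>mu_pow M k) < \<infinity>"
  shows "adapted_norm y m v < \<infinity>"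
proof -
  have "orbit_integral k v < \<infinity>" for k
    using orbit_integral_le[of k v] assms[of k]
    by (simp add: norm_powr_def ennreal_mult_less_top le_less_trans)
  then show ?thesis
    unfolding adapted_norm_def by (simp add: ennreal_mult_less_top)
qed

text \<open>
  Applying $T$ shifts the sum by one index. The new last term $y^{1-m}T^m|v|^t$ is at most
  $y\,|v|^t$ by the assumption on the power \<open>m\<close>, so it is compensated by the first term
  that the shift has removed.
\<close>
lemma adapted_norm_contraction:
  assumes "0 < y" "1 \<le> m" and m: "(\<integral>\<^sup>+X. wnorm X \<partial>mu_pow M m) \<le> ennreal (y ^ m)"
  shows "(\<integral>\<^sup>+A. W A * adapted_norm y m (A *v v) \<partial>M) \<le> ennreal y * adapted_norm y m v"
proof -
  note [measurable_cong] = sets_eq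
  obtain m' where m': "m = Suc m'"
    using assms by (cases m) auto
  have "(\<integral>\<^sup>+A. W A * adapted_norm y m (A *v v) \<partial>M) =
      (\<integral>\<^sup>+A. (\<Sum>k<m. ennreal (inverse y ^ k) * (W A * orbit_integral k (A *v v))) \<partial>M)"
    unfolding adapted_norm_def sum_distrib_left by (simp add: mult_ac)
  also have "\<dots> = (\<Sum>k<m. ennreal (inverse y ^ k) * orbit_integral (Suc k) v)"
    unfolding orbit_integral_Suc by (subst nn_integral_sum) (auto intro!: sum.cong nn_integral_cmult)
  also have "\<dots> = (\<Sum>k<m'. ennreal (inverse y ^ k) * orbit_integral (Suc k) v)
      + ennreal (inverse y ^ m') * orbit_integral m v"
    by (simp add: m')
  also have "ennreal (inverse y ^ m') * orbit_integral m v \<le> ennreal y * norm_powr t v"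
  proof -
    have "orbit_integral m v \<le> ennreal (y ^ m) * norm_powr t v"
      by (rule order_trans[OF orbit_integral_le mult_right_mono[OF m]]) simp
    then have "ennreal (inverse y ^ m') * orbit_integral m v
        \<le> ennreal (inverse y ^ m') * (ennreal (y ^ m) * norm_powr t v)"
      by (rule mult_left_mono) simp
    also have "\<dots> = ennreal (inverse y ^ m' * y ^ m) * norm_powr t v"
      using assms(1) by (subst ennreal_mult) (auto simp: mult.assoc)
    also have "inverse y ^ m' * y ^ m = y"
      using assms(1) by (simp add: m' field_simps)
    finally show ?thesis .
  qed
  also have "(\<Sum>k<m'. ennreal (inverse y ^ k) * orbit_integral (Suc k) v) + ennreal y * norm_powr t v
      = ennreal y * adapted_norm y m v"
  proof -
    have "ennreal y * (ennreal (inverse y ^ Suc k) * a) = ennreal (inverse y ^ k) * a" for k a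
      using assms(1) by (simp flip: mult.assoc ennreal_mult)
    then show ?thesis
      unfolding adapted_norm_def m' sum.lessThan_Suc_shift
      by (simp add: distrib_left sum_distrib_left orbit_integral_0 add.commute del: power_Suc)
  qed
  finally show ?thesis by (simp add: add_left_mono)
qed

text \<open>
  A near minimizer takes the place of a minimizer on the unit circle, whose existence would call
  for continuity. The infimum is finite and at least $1$, which leaves room for the factor $2$.
\<close>
lemma exists_almost_minimal_direction:
  assumes "1 \<le> m" "\<And>v. adapted_norm y m v < \<infinity>"
  shows "\<exists>e. norm e = 1 \<and> (\<forall>v. norm_powr t v * adapted_norm y m e \<le> 2 * adapted_norm y m v)"
proof -
  define \<alpha> where "\<alpha> = (INF v\<in>{v. norm v = 1}. adapted_norm y m v)"
  have "1 \<le> adapted_norm y m v" if "norm v = 1" for v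
    using norm_powr_le_adapted_norm[OF assms(1), of v y] that by (simp add: norm_powr_def)
  then have "1 \<le> \<alpha>"
    unfolding \<alpha>_def by (intro INF_greatest) auto
  have "\<alpha> \<le> adapted_norm y m (axis 1 1)"
    unfolding \<alpha>_def by (intro INF_lower) auto
  then have "\<alpha> < \<infinity>"
    using assms(2) by (rule le_less_trans)
  with \<open>1 \<le> \<alpha>\<close> have "\<alpha> < 2 * \<alpha>"
    by (cases \<alpha>) (auto simp flip: ennreal_numeral ennreal_mult ennreal_1 simp: ennreal_less_iff)
  then obtain e where e: "norm e = 1" "adapted_norm y m e < 2 * \<alpha>"
    unfolding \<alpha>_def INF_less_iff by auto
  have "norm_powr t v * adapted_norm y m e \<le> 2 * adapted_norm y m v" for v
  proof (cases "v = 0")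
    case True
    then show ?thesis by (simp add: norm_powr_def)
  next
    case False
    define u where "u = inverse (norm v) *\<^sub>R v"
    have u: "norm u = 1" "v = norm v *\<^sub>R u"
      using False by (auto simp: u_def)
    have "adapted_norm y m e \<le> 2 * \<alpha>" using e(2) by simp
    also have "\<dots> \<le> 2 * adapted_norm y m u"
      unfolding \<alpha>_def using u(1) by (intro mult_left_mono INF_lower) auto
    finally have "norm_powr t v * adapted_norm y m e \<le> norm_powr t v * (2 * adapted_norm y m u)"
      by (rule mult_left_mono) simp
    also have "\<dots> = 2 * (ennreal (\<bar>norm v\<bar> powr t) * adapted_norm y m u)"
      by (simp add: norm_powr_def mult_ac)
    also have "\<dots> = 2 * adapted_norm y m v"
      using u(2) adapted_norm_scaleR[of y m "norm v" u] by simp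
    finally show ?thesis .
  qed
  with e(1) show ?thesis by blast
qed

text \<open>
  Take the almost minimal direction \<open>e\<close> and the orthogonal direction \<open>e'\<close> as a basis. The
  contraction property bounds the average of the \<open>t\<close>-th power of the first column of \<open>A\<close> by
  $2y$, because the adapted norm of any vector is at least half its length to the power \<open>t\<close> times the adapted norm of \<open>e\<close>. It also
  bounds that of the lower right entry of \<open>A\<close> by $3y$: subtracting the \<open>e\<close>-component from
  \<open>A *v e'\<close> costs at most twice the adapted norm of that vector. The upper right entry has no such
  bound. But in a product \<open>X ** A\<close> this entry of \<open>A\<close> only meets the first column of \<open>X\<close>, so
  that every term of the product contains a factor that is controlled by \<open>y\<close>. The other
  factor is estimated by the norm, and $2+2+3=7$.
\<close>
lemma nn_integral_wnorm_mu_pow_2_le: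
  assumes fin: "\<And>k. (\<integral>\<^sup>+X. wnorm X \<partial>mu_pow M k) < \<infinity>"
    and "0 < y" "1 \<le> m" "(\<integral>\<^sup>+X. wnorm X \<partial>mu_pow M m) \<le> ennreal (y ^ m)"
  shows "(\<integral>\<^sup>+X. wnorm X \<partial>mu_pow M 2) \<le> 7 * ennreal y * (\<integral>\<^sup>+A. wnorm A \<partial>M)"
proof -
  note [measurable_cong] = sets_eq
  let ?g = "adapted_norm y m" and ?q = "norm_powr t" and ?I = "\<integral>\<^sup>+A. wnorm A \<partial>M"
  have g_fin: "?g v < \<infinity>" for v
    by (rule adapted_norm_finite[OF fin])
  obtain e where e: "norm e = 1" "\<And>v. ?q v * ?g e \<le> 2 * ?g v"
    using exists_almost_minimal_direction[OF \<open>1 \<le> m\<close> g_fin] by blast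
  define e' where "e' = perp e"
  have e': "norm e' = 1"
    using e(1) by (simp add: e'_def norm_perp)
  define d where "d A = ennreal (\<bar>inner e' (A *v e')\<bar> powr t)" for A :: mat2
  have [measurable]: "d \<in> borel_measurable borel"
    unfolding d_def by measurable
  \<comment> \<open>The adapted norm of a unit vector is finite and at least $1$, so it can be cancelled.\<close>
  have cancel: "a \<le> c" if "a * ?g v \<le> c * ?g v" "norm v = 1" for a c v
  proof -
    have "0 < ?g v"
      using norm_powr_le_adapted_norm[OF \<open>1 \<le> m\<close>, of v y] that(2)
      by (auto simp: norm_powr_def intro: less_le_trans[of _ 1])
    then show ?thesis
      using that(1) g_fin[of v]
      by (subst (asm) (1 2) mult.commute) (simp add: ennreal_mult_le_mult_iff less_top)
  qed
  have contraction: "(\<integral>\<^sup>+A. W A * ?g (A *v v) \<partial>M) \<le> ennreal y * ?g v" for v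
    by (rule adapted_norm_contraction[OF assms(2-4)])
  have col: "(\<integral>\<^sup>+A. W A * ?q (A *v e) \<partial>M) \<le> 2 * ennreal y"
  proof (rule cancel[OF _ e(1)])
    have "(\<integral>\<^sup>+A. W A * ?q (A *v e) \<partial>M) * ?g e = (\<integral>\<^sup>+A. W A * (?q (A *v e) * ?g e) \<partial>M)"
      by (subst nn_integral_multc[symmetric]) (auto simp: mult_ac)
    also have "\<dots> \<le> (\<integral>\<^sup>+A. 2 * (W A * ?g (A *v e)) \<partial>M)"
      using mult_left_mono[OF e(2), of "W _"] by (intro nn_integral_mono) (simp add: mult_ac)
    also have "\<dots> = 2 * (\<integral>\<^sup>+A. W A * ?g (A *v e) \<partial>M)"
      by (intro nn_integral_cmult) measurable
    also have "\<dots> \<le> 2 * (ennreal y * ?g e)"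
      by (intro mult_left_mono contraction) auto
    finally show "(\<integral>\<^sup>+A. W A * ?q (A *v e) \<partial>M) * ?g e \<le> 2 * ennreal y * ?g e"
      by (simp add: mult_ac)
  qed
  have diag: "(\<integral>\<^sup>+A. W A * d A \<partial>M) \<le> 3 * ennreal y"
  proof (rule cancel[OF _ e'])
    have d_le: "d A * ?g e' \<le> 3 * ?g (A *v e')" for A
    proof -
      let ?b = "inner e (A *v e')" and ?d = "inner e' (A *v e')"
      \<comment> \<open>The \<open>e\<close>-component is no longer than the whole vector, and \<open>e\<close> is almost minimal, so removing it costs at most twice the adapted norm of \<open>A *v e'\<close>.\<close>
      have "?d *\<^sub>R e' = A *v e' + (- ?b) *\<^sub>R e"
        using perp_expansion[OF e(1), of "A *v e'"] by (simp add: e'_def algebra_simps)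
      then have "d A * ?g e' = ?g (A *v e' + (- ?b) *\<^sub>R e)"
        unfolding d_def adapted_norm_scaleR[symmetric] by simp
      also have "\<dots> \<le> ?g (A *v e') + ennreal (\<bar>?b\<bar> powr t) * ?g e"
        using adapted_norm_add[of y m "A *v e'" "(- ?b) *\<^sub>R e"] by (simp only: adapted_norm_scaleR abs_minus_cancel)
      also have "ennreal (\<bar>?b\<bar> powr t) * ?g e \<le> ?q (A *v e') * ?g e"
        unfolding norm_powr_def using Cauchy_Schwarz_ineq2[of e "A *v e'"] e(1) t_pos
        by (intro mult_right_mono ennreal_leI powr_mono2) auto
      also have "\<dots> \<le> 2 * ?g (A *v e')"
        by (rule e(2))
      also have "?g (A *v e') + 2 * ?g (A *v e') = 3 * ?g (A *v e')"
        by (metis distrib_right mult_1 numeral_plus_one one_plus_numeral semiring_norm(3) semiring_norm(5))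
      finally show ?thesis by (simp add: add_left_mono)
    qed
    have "(\<integral>\<^sup>+A. W A * d A \<partial>M) * ?g e' = (\<integral>\<^sup>+A. W A * (d A * ?g e') \<partial>M)"
      by (subst nn_integral_multc[symmetric]) (auto simp: mult_ac)
    also have "\<dots> \<le> (\<integral>\<^sup>+A. 3 * (W A * ?g (A *v e')) \<partial>M)"
      using mult_left_mono[OF d_le, of "W _"] by (intro nn_integral_mono) (simp add: mult_ac)
    also have "\<dots> = 3 * (\<integral>\<^sup>+A. W A * ?g (A *v e') \<partial>M)"
      by (intro nn_integral_cmult) measurable
    also have "\<dots> \<le> 3 * (ennreal y * ?g e')"
      by (intro mult_left_mono contraction) auto
    finally show "(\<integral>\<^sup>+A. W A * d A \<partial>M) * ?g e' \<le> 3 * ennreal y * ?g e'"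
      by (simp add: mult_ac)
  qed
  have pointwise: "wnorm (X ** A) \<le> wnorm X * (W A * ?q (A *v e)) + W X * ?q (X *v e) * wnorm A
      + wnorm X * (W A * d A)" for X A
  proof -
    let ?b = "inner e (A *v e')"
    let ?sX = "ennreal (sigma1 X powr t)" and ?sA = "ennreal (sigma1 A powr t)"
    have "ennreal (sigma1 (X ** A) powr t) \<le> ?q (X *v (A *v e)) + ?q (X *v (A *v e'))"
      using sigma1_powr_le_norm_powr[OF t_pos t_le_1 e(1), of "X ** A"]
      by (simp add: matrix_vector_mul_assoc e'_def)
    also have "?q (X *v (A *v e)) \<le> ?sX * ?q (A *v e)"
      by (rule norm_powr_matrix_vector_le[OF t_pos])
    also have "?q (X *v (A *v e')) \<le> ?sA * ?q (X *v e) + d A * ?sX"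
    proof -
      have "X *v (A *v e') = ?b *\<^sub>R (X *v e) + inner e' (A *v e') *\<^sub>R (X *v e')"
        by (subst perp_expansion[OF e(1), of "A *v e'"])
          (simp add: e'_def matrix_vector_right_distrib matrix_vector_mult_scaleR)
      then have "?q (X *v (A *v e')) \<le> ennreal (\<bar>?b\<bar> powr t) * ?q (X *v e) + d A * ?q (X *v e')"
        unfolding d_def norm_powr_scaleR[symmetric] by (simp add: norm_powr_add t_pos t_le_1)
      also have "\<dots> \<le> ?sA * ?q (X *v e) + d A * ?sX"
      proof (intro add_mono mult_right_mono mult_left_mono)
        have "\<bar>?b\<bar> \<le> norm (A *v e')"
          using Cauchy_Schwarz_ineq2[of e "A *v e'"] e(1) by simp
        also have "\<dots> \<le> sigma1 A"
          using norm_matrix_vector_le_sigma1[of A e'] e' by simp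
        finally show "ennreal (\<bar>?b\<bar> powr t) \<le> ?sA"
          using t_pos by (intro ennreal_leI powr_mono2) auto
        show "?q (X *v e') \<le> ?sX"
          using norm_powr_matrix_vector_le[OF t_pos, of X e'] e' by (simp add: norm_powr_def)
      qed auto
      finally show ?thesis .
    qed
    finally have "ennreal (sigma1 (X ** A) powr t) \<le>
        ?sX * ?q (A *v e) + (?sA * ?q (X *v e) + d A * ?sX)"
      by (simp add: add_mono)
    then have "wnorm (X ** A) \<le> W X * W A * (?sX * ?q (A *v e) + (?sA * ?q (X *v e) + d A * ?sX))"
      unfolding wnorm_def W_mult by (rule mult_left_mono) simp
    also have "\<dots> = wnorm X * (W A * ?q (A *v e)) + W X * ?q (X *v e) * wnorm A + wnorm X * (W A * d A)"
      unfolding wnorm_def by (simp add: algebra_simps)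
    finally show ?thesis .
  qed
  have "(\<integral>\<^sup>+X. wnorm X \<partial>mu_pow M 2) \<le> (\<integral>\<^sup>+A. (\<integral>\<^sup>+X. wnorm X * (W A * ?q (A *v e))
      + W X * ?q (X *v e) * wnorm A + wnorm X * (W A * d A) \<partial>M) \<partial>M)"
    unfolding nn_integral_mu_pow_2[OF wnorm_measurable] by (intro nn_integral_mono pointwise)
  also have "\<dots> = ?I * (\<integral>\<^sup>+A. W A * ?q (A *v e) \<partial>M) + (\<integral>\<^sup>+A. W A * ?q (A *v e) \<partial>M) * ?I
      + ?I * (\<integral>\<^sup>+A. W A * d A \<partial>M)"
    by (simp add: nn_integral_add nn_integral_multc nn_integral_cmult)
  also have "\<dots> \<le> ?I * (2 * ennreal y) + 2 * ennreal y * ?I + ?I * (3 * ennreal y)"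
    by (intro add_mono mult_left_mono mult_right_mono col diag) auto
  also have "\<dots> = 7 * ennreal y * ?I"
  proof -
    have "2 * x + 2 * x + 3 * x = 7 * x" for x :: ennreal
      by (simp flip: distrib_right)
    from this[of "ennreal y * ?I"] show ?thesis
      by (simp add: mult_ac)
  qed
  finally show ?thesis .
qed

end

section \<open>Growth rates of submultiplicative sequences\<close>

definition growth_rate :: "(nat \<Rightarrow> ennreal) \<Rightarrow> nat \<Rightarrow> ereal" where
  "growth_rate a n = ereal (1 / real n) * log_ext (a n)"

text \<open>
  This translates between growth rates and geometric bounds and keeps the convention for
  $\log 0$ out of the estimates below.
\<close>
lemma growth_rate_le_iff:
  assumes "1 \<le> n" "0 < y"
  shows "growth_rate a n \<le> ereal (ln y) \<longleftrightarrow> a n \<le> ennreal (y ^ n)"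
proof (cases "a n")
  case (real r)
  show ?thesis
  proof (cases "r = 0")
    case True
    then show ?thesis
      using real assms by (simp add: growth_rate_def log_ext_def)
  next
    case False
    with real have r: "0 < r" by simp
    have "growth_rate a n = ereal (ln r / real n)"
      using r real by (simp add: growth_rate_def log_ext_def)
    moreover have "ln r / real n \<le> ln y \<longleftrightarrow> ln r \<le> ln (y ^ n)"
      using assms by (simp add: ln_realpow pos_divide_le_eq mult.commute)
    moreover have "\<dots> \<longleftrightarrow> r \<le> y ^ n"
      using r assms by (intro ln_le_cancel_iff) auto
    ultimately show ?thesis
      using real assms by simp
  qed
next
  case top
  then have "growth_rate a n = \<infinity>"
    using assms by (simp add: growth_rate_def log_ext_def)
  with top show ?thesis by (simp add: top_unique)
qed

text \<open>
  Division with remainder by \<open>m\<close>: the constant accounts for the remainders.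
\<close>
lemma submultiplicative_geometric_bound:
  fixes a :: "nat \<Rightarrow> ennreal"
  assumes submult: "\<And>m n. a (m + n) \<le> a m * a n" and fin: "\<And>n. a n < \<infinity>"
    and "1 \<le> m" "0 < y" "a m \<le> ennreal (y ^ m)"
  shows "\<exists>C. \<forall>n. a n \<le> ennreal (C * y ^ n)"
proof -
  define C where "C = (\<Sum>r<m. enn2real (a r) / y ^ r)"
  have nonneg: "0 \<le> C"
    unfolding C_def using \<open>0 < y\<close> by (intro sum_nonneg) auto
  have "a n \<le> ennreal (C * y ^ n)" for n
  proof (induction n rule: less_induct)
    case (less n)
    show ?case
    proof (cases "n < m")
      case True
      then have "enn2real (a n) / y ^ n \<le> C"
        unfolding C_def using \<open>0 < y\<close> by (intro member_le_sum) auto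
      then have "enn2real (a n) \<le> C * y ^ n"
        using \<open>0 < y\<close> by (simp add: pos_divide_le_eq)
      then show ?thesis
        using fin[of n] by (metis ennreal_enn2real ennreal_leI infinity_ennreal_def)
    next
      case False
      then have "a n \<le> a m * a (n - m)"
        using submult[of m "n - m"] by simp
      also have "\<dots> \<le> ennreal (y ^ m) * ennreal (C * y ^ (n - m))"
        using False assms(3) by (intro mult_mono assms(5) less) auto
      also have "\<dots> = ennreal (C * (y ^ m * y ^ (n - m)))"
        using nonneg \<open>0 < y\<close> by (subst ennreal_mult[symmetric]) (auto simp: mult_ac)
      also have "y ^ m * y ^ (n - m) = y ^ n"
        using False by (simp flip: power_add)
      finally show ?thesis .
    qed
  qed
  then show ?thesis by blast
qed

text \<open>
  Fekete's lemma, with the limit in the extended reals. A geometric bound with base $e^b$ holds up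
  to a constant, and the constant is absorbed by passing to a slightly larger base $e^c$.
\<close>
lemma growth_rate_tendsto_INF:
  fixes a :: "nat \<Rightarrow> ennreal"
  assumes submult: "\<And>m n. a (m + n) \<le> a m * a n" and fin: "\<And>n. a n < \<infinity>"
  shows "growth_rate a \<longlonglongrightarrow> (INF n\<in>{1..}. growth_rate a n)"
proof (rule order_tendstoI)
  fix l assume "l < (INF n\<in>{1..}. growth_rate a n)"
  then have "l < growth_rate a n" if "1 \<le> n" for n
    using that by (auto intro: less_le_trans INF_lower)
  then show "\<forall>\<^sub>F n in sequentially. l < growth_rate a n"
    by (auto intro: eventually_sequentiallyI)
next
  fix u assume "(INF n\<in>{1..}. growth_rate a n) < u"
  then obtain m where m: "1 \<le> m" "growth_rate a m < u"
    by (auto simp: INF_less_iff)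
  then obtain b where b: "growth_rate a m < ereal b" "ereal b < u"
    using ereal_dense2 by blast
  then obtain c where c: "b < c" "ereal c < u"
    using ereal_dense2[of "ereal b" u] by auto
  have "a m \<le> ennreal (exp b ^ m)"
    using less_imp_le[OF b(1)] growth_rate_le_iff[OF m(1), of "exp b" a] by simp
  then obtain C where C: "\<And>n. a n \<le> ennreal (C * exp b ^ n)"
    using submultiplicative_geometric_bound[OF submult fin m(1), of "exp b"] by auto
  obtain k where "C < exp (c - b) ^ k"
    using real_arch_pow[of "exp (c - b)" C] c(1) by auto
  then have "C \<le> exp (c - b) ^ n" if "k \<le> n" for n
    using c(1) by (intro order_trans[OF less_imp_le power_increasing[OF that]]) auto
  then have "\<forall>\<^sub>F n in sequentially. C \<le> exp (c - b) ^ n"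
    by (rule eventually_sequentiallyI)
  with eventually_ge_at_top[of 1] show "\<forall>\<^sub>F n in sequentially. growth_rate a n < u"
  proof eventually_elim
    case (elim n)
    then have "C * exp b ^ n \<le> exp (c - b) ^ n * exp b ^ n"
      by (intro mult_right_mono) auto
    also have "\<dots> = exp c ^ n"
      by (simp flip: power_mult_distrib exp_add)
    finally have "a n \<le> ennreal (exp c ^ n)"
      using C[of n] by (meson ennreal_leI order_trans)
    then have "growth_rate a n \<le> ereal c"
      using growth_rate_le_iff[OF elim(1), of "exp c" a] by simp
    with c(2) show ?case by simp
  qed
qed

text \<open>
  Since the limit is an infimum, every \<open>y\<close> above its exponential satisfies $a_m\le y^m$ for some
  \<open>m\<close>. An estimate that holds for all such \<open>y\<close> passes to the exponential of the limit.
\<close>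
lemma le_exp_ext_lim_growth_rate:
  fixes a :: "nat \<Rightarrow> ennreal" and c :: real
  assumes submult: "\<And>m n. a (m + n) \<le> a m * a n" and fin: "\<And>n. a n < \<infinity>"
    and "0 \<le> c" "b < \<infinity>"
    and bound: "\<And>y m. 0 < y \<Longrightarrow> 1 \<le> m \<Longrightarrow> a m \<le> ennreal (y ^ m) \<Longrightarrow> x \<le> ennreal c * ennreal y * b"
  shows "x \<le> ennreal c * exp_ext (lim (growth_rate a)) * b"
proof -
  define P where "P = lim (growth_rate a)"
  have P_eq: "P = (INF n\<in>{1..}. growth_rate a n)"
    unfolding P_def by (intro limI growth_rate_tendsto_INF submult fin)
  have "growth_rate a 1 < \<infinity>"
    using fin[of 1] by (auto simp: growth_rate_def log_ext_def one_ereal_def[symmetric])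
  then have "P < \<infinity>"
    unfolding P_eq by (rule le_less_trans[OF INF_lower, rotated]) simp
  define E where "E = enn2real (exp_ext P)"
  have E: "exp_ext P = ennreal E" "0 \<le> E"
    using \<open>P < \<infinity>\<close> by (auto simp: E_def exp_ext_def)
  have le_y: "x \<le> ennreal c * ennreal y * b" if "E < y" for y
  proof -
    have "0 < y" using E(2) that by simp
    have "P < ereal (ln y)"
    proof (cases P)
      case (real p)
      then have "exp p < y" using that by (simp add: E_def exp_ext_def)
      then show ?thesis
        using real \<open>0 < y\<close> by (metis exp_less_cancel_iff exp_ln less_ereal.simps(1))
    qed (use \<open>P < \<infinity>\<close> in auto)
    then obtain m where "1 \<le> m" "growth_rate a m < ereal (ln y)"
      unfolding P_eq by (auto simp: INF_less_iff)
    then show ?thesis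
      using bound[OF \<open>0 < y\<close>] growth_rate_le_iff[OF _ \<open>0 < y\<close>, of m a] less_imp_le by blast
  qed
  obtain b' where b': "b = ennreal b'" "0 \<le> b'"
    using \<open>b < \<infinity>\<close> by (cases b) auto
  have "((\<lambda>y. ennreal (c * y * b')) \<longlongrightarrow> ennreal (c * E * b')) (at_right E)"
    by (intro tendsto_ennrealI tendsto_intros)
  moreover have "\<forall>\<^sub>F y in at_right E. x \<le> ennreal (c * y * b')"
    using eventually_at_right_less[of E]
  proof eventually_elim
    case (elim y)
    with le_y[OF elim] E(2) b' \<open>0 \<le> c\<close> show ?case
      by (simp add: ennreal_mult)
  qed
  ultimately have "x \<le> ennreal (c * E * b')"
    by (intro tendsto_lowerbound[where F = "at_right E"]) auto
  then show ?thesis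
    using E b' \<open>0 \<le> c\<close> by (simp add: ennreal_mult flip: P_def)
qed

section \<open>The bound for the singular value function\<close>

text \<open>
  The reduction that all ranges of \<open>s\<close> share. It leaves an estimate for a
  \<open>\<sigma>\<close>-finite measure and a single pair \<open>y\<close>, \<open>m\<close> with a geometric bound on the \<open>m\<close>-th power.
\<close>
lemma nn_integral_mu_pow_2_le_growth_rate:
  fixes c :: real
  assumes sets: "sets M = sets borel" and g [measurable]: "g \<in> borel_measurable borel"
    and submult: "\<And>X Y. g (X ** Y) \<le> g X * g Y" and one: "g (mat 1) < \<infinity>"
    and fin: "(\<integral>\<^sup>+A. g A \<partial>M) < \<infinity>" and "0 \<le> c"
    and bound: "\<And>N y m. \<lbrakk>sigma_finite_mat2 N; \<And>k. (\<integral>\<^sup>+X. g X \<partial>mu_pow N k) < \<infinity>; 0 < y; 1 \<le> m;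
        (\<integral>\<^sup>+X. g X \<partial>mu_pow N m) \<le> ennreal (y ^ m)\<rbrakk>
      \<Longrightarrow> (\<integral>\<^sup>+X. g X \<partial>mu_pow N 2) \<le> ennreal c * ennreal y * (\<integral>\<^sup>+A. g A \<partial>N)"
  shows "(\<integral>\<^sup>+X. g X \<partial>mu_pow M 2)
    \<le> ennreal c * exp_ext (lim (growth_rate (\<lambda>n. \<integral>\<^sup>+X. g X \<partial>mu_pow M n))) * (\<integral>\<^sup>+A. g A \<partial>M)"
proof -
  note [measurable_cong] = sets
  let ?N = "nonvanishing_part M g"
  have same: "(\<integral>\<^sup>+X. g X \<partial>mu_pow M n) = (\<integral>\<^sup>+X. g X \<partial>mu_pow ?N n)" for n
    by (rule nn_integral_mu_pow_nonvanishing_part[OF sets g submult fin])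
  have N: "sigma_finite_mat2 ?N"
    using sigma_finite_nonvanishing_part[OF sets g fin] sets
    by (simp add: sigma_finite_mat2_def sigma_finite_mat2_axioms_def)
  then interpret sigma_finite_mat2 ?N .
  have "(\<integral>\<^sup>+A. g A \<partial>?N) = (\<integral>\<^sup>+A. indicator {A. g A \<noteq> 0} A * g A \<partial>M)"
    unfolding nonvanishing_part_def by (rule nn_integral_density) measurable
  also have "\<dots> = (\<integral>\<^sup>+A. g A \<partial>M)"
    by (intro nn_integral_cong) (auto split: split_indicator)
  finally have same_1: "(\<integral>\<^sup>+A. g A \<partial>?N) = (\<integral>\<^sup>+A. g A \<partial>M)" .
  have finite: "(\<integral>\<^sup>+X. g X \<partial>mu_pow ?N n) < \<infinity>" for n
  proof (induction n)
    case 0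
    then show ?case using one by (simp add: nn_integral_mu_pow_0[OF sets_eq g])
  next
    case (Suc n)
    have "(\<integral>\<^sup>+X. g X \<partial>mu_pow ?N (n + 1)) \<le> (\<integral>\<^sup>+X. g X \<partial>mu_pow ?N n) * (\<integral>\<^sup>+A. g A \<partial>M)"
      using nn_integral_mu_pow_submult[OF g submult, of n 1]
      by (simp only: nn_integral_mu_pow_1[OF g] same_1)
    also have "\<dots> < \<infinity>"
      using Suc fin by (simp add: ennreal_mult_less_top)
    finally show ?case by (simp only: Suc_eq_plus1)
  qed
  show ?thesis
    unfolding same
  proof (rule le_exp_ext_lim_growth_rate[OF _ finite \<open>0 \<le> c\<close> fin])
    show "(\<integral>\<^sup>+X. g X \<partial>mu_pow ?N (m + n))
        \<le> (\<integral>\<^sup>+X. g X \<partial>mu_pow ?N m) * (\<integral>\<^sup>+X. g X \<partial>mu_pow ?N n)" for m n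
      by (rule nn_integral_mu_pow_submult[OF g submult])
  qed (use bound[OF N finite] in \<open>simp add: same_1\<close>)
qed

lemma (in sigma_finite_mat2) nn_integral_mu_pow_mult:
  assumes [measurable]: "g \<in> borel_measurable borel"
    and "\<And>X Y. g (X ** Y) = g X * g Y"
  shows "(\<integral>\<^sup>+X. g X \<partial>mu_pow M (Suc n)) = (\<integral>\<^sup>+A. g A \<partial>M) ^ Suc n"
proof (induction n)
  case 0
  then show ?case
    using nn_integral_mu_pow_1[OF assms(1)] by (simp add: One_nat_def)
next
  case (Suc n)
  have "(\<integral>\<^sup>+X. g X \<partial>mu_pow M (Suc (Suc n))) = (\<integral>\<^sup>+A. (\<integral>\<^sup>+X. g X * g A \<partial>mu_pow M (Suc n)) \<partial>M)"
    by (simp only: nn_integral_mu_pow_Suc[OF assms(1)] assms(2))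
  also have "\<dots> = (\<integral>\<^sup>+X. g X \<partial>mu_pow M (Suc n)) * (\<integral>\<^sup>+A. g A \<partial>M)"
    using sets_eq by (simp add: nn_integral_multc nn_integral_cmult cong: measurable_cong_sets)
  finally show ?case
    by (simp add: Suc.IH mult.commute)
qed

text \<open>
  For a multiplicative integrand the integrals form a geometric sequence, so any geometric
  bound is already a bound on the first of them.
\<close>
lemma (in sigma_finite_mat2) nn_integral_mu_pow_2_le_mult:
  assumes g: "g \<in> borel_measurable borel" "\<And>X Y. g (X ** Y) = g X * g Y"
    and "0 < y" "1 \<le> m" "(\<integral>\<^sup>+X. g X \<partial>mu_pow M m) \<le> ennreal (y ^ m)"
  shows "(\<integral>\<^sup>+X. g X \<partial>mu_pow M 2) \<le> ennreal y * (\<integral>\<^sup>+A. g A \<partial>M)"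
proof -
  let ?I = "\<integral>\<^sup>+A. g A \<partial>M"
  obtain n where n: "m = Suc n"
    using \<open>1 \<le> m\<close> by (cases m) auto
  have pow: "?I ^ m \<le> ennreal (y ^ m)"
    using assms(5) nn_integral_mu_pow_mult[OF g, of n] by (simp only: n)
  have "?I \<le> ennreal y"
  proof (cases ?I)
    case (real r)
    with pow \<open>0 < y\<close> have "r ^ m \<le> y ^ m"
      by (simp add: ennreal_power)
    then have "r \<le> y"
      using real \<open>0 < y\<close> \<open>1 \<le> m\<close> by (subst (asm) power_mono_iff) auto
    with real show ?thesis by (simp add: ennreal_leI)
  next
    case top
    with pow show ?thesis by (simp add: n ennreal_top_mult top_unique)
  qed
  then show ?thesis
    using nn_integral_mu_pow_mult[OF g, of 1]
    by (simp add: Suc_1 power2_eq_square mult_right_mono)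
qed

lemma K_tilde_ge_7:
  assumes "0 < s" "s < 2"
  shows "7 \<le> K_tilde s"
proof -
  have "2 powr 3 \<le> (2::real) powr (if s \<le> 1 then 3 + 2 * s else 7 - 2 * s)"
    using assms by (intro powr_mono) auto
  also have "\<dots> = K_tilde s"
    using assms by (simp add: K_tilde_def)
  finally show ?thesis by simp
qed

theorem theorem2p6:
  fixes \<mu> :: "mat2 measure" and s :: real
  assumes "sets \<mu> = sets borel"
    and "s > 0"
    and "(\<integral>\<^sup>+A. ennreal (phi s A) \<partial>\<mu>) < \<infinity>"
  shows "(\<integral>\<^sup>+A. ennreal (phi s A) \<partial>mu_pow \<mu> 2)
         \<le> ennreal (K_tilde s) * exp_ext (pressure \<mu> s) * (\<integral>\<^sup>+A. ennreal (phi s A) \<partial>\<mu>)"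
proof -
  let ?g = "\<lambda>A. ennreal (phi s A)"
  have submult: "?g (X ** Y) \<le> ?g X * ?g Y" for X Y
    using phi_mult_le[OF \<open>s > 0\<close>, of X Y]
    by (simp add: phi_nonneg ennreal_leI flip: ennreal_mult)
  have K: "0 \<le> K_tilde s"
    by (simp add: K_tilde_def)
  have weighted: "(\<integral>\<^sup>+X. ?g X \<partial>mu_pow N 2) \<le> ennreal (K_tilde s) * ennreal y * (\<integral>\<^sup>+A. ?g A \<partial>N)"
    if "s < 2" and N: "weighted_norm N W t" and g: "?g = weighted_norm.wnorm W t"
      and "\<And>k. (\<integral>\<^sup>+X. ?g X \<partial>mu_pow N k) < \<infinity>" "0 < y" "1 \<le> m"
      "(\<integral>\<^sup>+X. ?g X \<partial>mu_pow N m) \<le> ennreal (y ^ m)" for N W t y m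
  proof -
    have "(\<integral>\<^sup>+X. ?g X \<partial>mu_pow N 2) \<le> 7 * ennreal y * (\<integral>\<^sup>+A. ?g A \<partial>N)"
      using weighted_norm.nn_integral_wnorm_mu_pow_2_le[OF N] that(4-7) unfolding g by blast
    also have "\<dots> \<le> ennreal (K_tilde s) * ennreal y * (\<integral>\<^sup>+A. ?g A \<partial>N)"
      using ennreal_leI[OF K_tilde_ge_7[OF \<open>s > 0\<close> \<open>s < 2\<close>]] by (intro mult_right_mono) auto
    finally show ?thesis .
  qed
  have "(\<integral>\<^sup>+X. ?g X \<partial>mu_pow N 2) \<le> ennreal (K_tilde s) * ennreal y * (\<integral>\<^sup>+A. ?g A \<partial>N)"
    if "sigma_finite_mat2 N" and *: "\<And>k. (\<integral>\<^sup>+X. ?g X \<partial>mu_pow N k) < \<infinity>" "0 < y" "1 \<le> m"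
      "(\<integral>\<^sup>+X. ?g X \<partial>mu_pow N m) \<le> ennreal (y ^ m)" for N y m
  proof -
    interpret N: sigma_finite_mat2 N by fact
    consider "s \<le> 1" | "1 < s" "s < 2" | "2 \<le> s" by linarith
    then show ?thesis
    proof cases
      case 1
      interpret weighted_norm N "\<lambda>_. 1" s
        using 1 \<open>s > 0\<close> by unfold_locales auto
      have "?g = wnorm"
        using 1 by (simp add: fun_eq_iff wnorm_def phi_eq_le_1)
      with 1 show ?thesis
        by (intro weighted[OF _ weighted_norm_axioms _ *]) auto
    next
      case 2
      interpret weighted_norm N "\<lambda>A. ennreal (\<bar>det A\<bar> powr (s - 1))" "2 - s"
        using 2 by unfold_locales (auto simp: det_powr_mult ennreal_mult)
      have "?g = wnorm"
        using 2 by (simp add: fun_eq_iff wnorm_def phi_eq_between ennreal_mult)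
      with 2 show ?thesis
        by (intro weighted[OF _ weighted_norm_axioms _ *]) auto
    next
      case 3
      then have "?g (X ** Y) = ?g X * ?g Y" for X Y
        by (simp add: phi_eq_ge_2 det_powr_mult ennreal_mult)
      then have "(\<integral>\<^sup>+X. ?g X \<partial>mu_pow N 2) \<le> ennreal y * (\<integral>\<^sup>+A. ?g A \<partial>N)"
        using * by (intro N.nn_integral_mu_pow_2_le_mult) auto
      with 3 show ?thesis by (simp add: K_tilde_def)
    qed
  qed
  from nn_integral_mu_pow_2_le_growth_rate[OF assms(1) _ submult _ assms(3) K this]
  show ?thesis
    by (simp add: pressure_def growth_rate_def[abs_def])
qed

end
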